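(* Let $G$ be a simple graph on $l$ vertices, with chromatic polynomial $\chi(G;q)$ and bond lattice $L_G$ with minimal element $\hat 0$. Then $$\chi(G;q)=\sum_{p}(-1)^{\operatorname{len}(p)}\,w(p)\,q^{\,l-\operatorname{len}(p)},$$ where the sum is over all directed paths $p$ in $L_G$ with $\operatorname{end}(p)=\hat 0$ (and arbitrary starting point), and $w(p)$ is the weight of $p$.
   Context: $G$ is a simple graph on $l$ vertices, not assumed connected, with vertex set $\Pi$. The chromatic polynomial $\chi(G;q)$ is the polynomial in $q$ whose value at each positive integer $q$ is the number of proper vertex colorings of $G$ with $q$ colors. A non-empty $S\subset\Pi$ is called connected if the subgraph of $G$ induced by $S$ is connected. The bond lattice $L_G$ is the set of all partitions $\pi=\{S_1,\dots,S_k\}$ of $\Pi$ into non-empty pairwise disjoint connected subsets, partially ordered by refinement: $\pi\ge\pi'$ iff $\pi'$ refines $\pi$. $\hat 0$ is the partition into $l$ singletons. For $\pi=\{S_1,\dots,S_k\}\in L_G$, $d(\pi):=\#\{1\le i\le k:|S_i|>1\}$ is the number of non-singleton parts. For $S\subset\Pi$, $\boldsymbol{e}(S)$ is the number of edges of $G$ with both ends in $S$; for disjoint $S,S'$, $\boldsymbol{e}(S,S')$ is the number of edges of $G$ with one end in $S$ and the other in $S'$. $L_G$ is viewed as a directed graph with an edge $\pi\rightarrow\pi'$ whenever $\pi$ covers $\pi'$ in $L_G$. In that case one can write $\pi=\{S_1,\dots,S_k\}$, $\pi'=\{S'_1,\dots,S'_{k+1}\}$ with $S_i=S'_i$ for $1\le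 i<k$ and $S_k=S'_k\sqcup S'_{k+1}$, and the weight of the edge is $$w(\pi,\pi'):=\frac{1}{d(\pi)}\,\frac{\boldsymbol{e}(S'_k,S'_{k+1})}{\boldsymbol{e}(S_k)}.$$ For a directed path $p:\pi_1\rightarrow\pi_2\rightarrow\cdots\rightarrow\pi_r$ ($r\ge1$), $\operatorname{end}(p):=\pi_r$, $\operatorname{len}(p):=r-1$, and $w(p):=\prod_{i=1}^{r-1}w(\pi_i,\pi_{i+1})$, with $w(p):=1$ if $r=1$. *)

theory Defs
  imports
    "Graph_Theory.Graph_Theory"
    "HOL-Library.Disjoint_Sets"
    "HOL-Computational_Algebra.Polynomial"
begin

text \<open>
  Finite simple graphs are the library's \<^locale>\<open>pair_graph\<close>s: \<^term>\<open>pverts G\<close> is a finite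
  vertex set and \<^term>\<open>parcs G\<close> a symmetric irreflexive relation on it, so that each
  undirected edge is represented by its two orientations.
\<close>


section \<open>The chromatic polynomial\<close>

definition proper_colorings :: "'a pair_pre_digraph \<Rightarrow> nat \<Rightarrow> ('a \<Rightarrow> nat) set" where
  "proper_colorings G q =
    {c \<in> pverts G \<rightarrow>\<^sub>E {..<q}. \<forall>(u, v) \<in> parcs G. c u \<noteq> c v}"

definition is_chromatic_polynomial :: "'a pair_pre_digraph \<Rightarrow> rat poly \<Rightarrow> bool" where
  "is_chromatic_polynomial G f \<longleftrightarrow>
    (\<forall>q>0. poly f (of_nat q) = of_nat (card (proper_colorings G q)))"

text \<open>Well defined for every \<^locale>\<open>pair_graph\<close>; see \<open>chromatic_polynomial_ex1\<close>.\<close>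
definition chromatic_polynomial :: "'a pair_pre_digraph \<Rightarrow> rat poly" where
  "chromatic_polynomial G = (THE f. is_chromatic_polynomial G f)"

lemma card_proper_colorings_image:
  assumes G: "pair_graph G" and I: "I \<subseteq> {..<q}"
  shows "card {c \<in> proper_colorings G q. c ` pverts G = I}
       = card {c \<in> proper_colorings G (card I). c ` pverts G = {..<card I}}"
proof -
  interpret pair_graph G by fact
  have "finite I" using I finite_subset by blast
  then obtain h where h: "bij_betw h {..<card I} I"
    using ex_bij_betw_nat_finite[of I] by (auto simp: atLeast0LessThan)
  define g where "g = inv_into {..<card I} h"
  have g: "bij_betw g I {..<card I}"
    unfolding g_def using h by (rule bij_betw_inv_into)
  have gh: "g (h i) = i" if "i < card I" for i
    unfolding g_def using h that by (simp add: bij_betw_inv_into_left)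
  have hg: "h (g i) = i" if "i \<in> I" for i
    unfolding g_def using h that by (simp add: bij_betw_inv_into_right)
  have hI: "h i \<in> I" if "i < card I" for i
    using h that by (auto simp: bij_betw_def)
  have gI: "g i < card I" if "i \<in> I" for i
    using g that by (auto simp: bij_betw_def)
  have V: "u \<in> pverts G \<and> v \<in> pverts G" if "(u, v) \<in> parcs G" for u v
    using that in_arcsD1 in_arcsD2 by blast
  let ?A = "{c \<in> proper_colorings G q. c ` pverts G = I}"
  let ?B = "{c \<in> proper_colorings G (card I). c ` pverts G = {..<card I}}"
  have "bij_betw (\<lambda>c. restrict (g \<circ> c) (pverts G)) ?A ?B"
  proof (rule bij_betw_byWitness[where f' = "\<lambda>c. restrict (h \<circ> c) (pverts G)"])
    show "\<forall>c\<in>?A. restrict (h \<circ> restrict (g \<circ> c) (pverts G)) (pverts G) = c"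
      by (auto simp: proper_colorings_def fun_eq_iff restrict_def PiE_def extensional_def hg)
    show "\<forall>c\<in>?B. restrict (g \<circ> restrict (h \<circ> c) (pverts G)) (pverts G) = c"
      by (auto simp: proper_colorings_def fun_eq_iff restrict_def PiE_def extensional_def gh Pi_def)
    show "(\<lambda>c. restrict (g \<circ> c) (pverts G)) ` ?A \<subseteq> ?B"
    proof clarify
      fix c assume c: "c \<in> proper_colorings G q" and cI: "I = c ` pverts G"
      have "g (c u) \<noteq> g (c v)" if "(u, v) \<in> parcs G" for u v
        using V[OF that] that c hg cI unfolding proper_colorings_def
        by (metis (mono_tags, lifting) case_prodD image_eqI mem_Collect_eq)
      moreover have "g ` c ` pverts G = {..<card I}"
        using g cI by (simp add: bij_betw_def)
      ultimately show "restrict (g \<circ> c) (pverts G) \<in> proper_colorings G (card (c ` pverts G)) \<and>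
          restrict (g \<circ> c) (pverts G) ` pverts G = {..<card (c ` pverts G)}"
        using V cI gI by (auto simp: proper_colorings_def image_comp)
    qed
    show "(\<lambda>c. restrict (h \<circ> c) (pverts G)) ` ?B \<subseteq> ?A"
    proof clarify
      fix c assume c: "c \<in> proper_colorings G (card I)" and cI: "c ` pverts G = {..<card I}"
      have lt: "c u < card I" if "u \<in> pverts G" for u
        using cI that by blast
      have "h (c u) \<noteq> h (c v)" if "(u, v) \<in> parcs G" for u v
        using V[OF that] that c gh lt unfolding proper_colorings_def
        by (metis (mono_tags, lifting) case_prodD mem_Collect_eq)
      moreover have "(h \<circ> c) ` pverts G = I"
        using h cI by (metis bij_betw_def image_comp)
      ultimately show "restrict (h \<circ> c) (pverts G) \<in> proper_colorings G q \<and>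
          restrict (h \<circ> c) (pverts G) ` pverts G = I"
        using V lt hI I by (auto simp: proper_colorings_def)
    qed
  qed
  then show ?thesis by (rule bij_betw_same_card)
qed

lemma chromatic_polynomial_ex1:
  assumes G: "pair_graph G"
  shows "\<exists>!f. is_chromatic_polynomial G f"
proof (rule ex_ex1I)
  interpret pair_graph G by fact
  let ?l = "card (pverts G)"
  define a where "a k = card {c \<in> proper_colorings G k. c ` pverts G = {..<k}}" for k
  define f :: "rat poly" where
    "f = (\<Sum>k\<le>?l. smult (of_nat (a k) / fact k) (\<Prod>i<k. [:- of_nat i, 1:]))"
  have "card (proper_colorings G q) = (\<Sum>k\<le>?l. (q choose k) * a k)" for q
  proof -
    have fin: "finite (proper_colorings G q)"
      using finite_PiE[OF pair_finite_verts, of "\<lambda>_. {..<q}"] by (simp add: proper_colorings_def)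
    have a0: "a k = 0" if "k > ?l" for k
    proof -
      have "c ` pverts G \<noteq> {..<k}" for c :: "'a \<Rightarrow> nat"
        using card_image_le[OF pair_finite_verts, of c] that by auto
      then show ?thesis by (simp add: a_def)
    qed
    have "card (proper_colorings G q)
        = card (\<Union>I\<in>Pow {..<q}. {c \<in> proper_colorings G q. c ` pverts G = I})"
      by (rule arg_cong[where f = card]) (auto simp: proper_colorings_def)
    also have "\<dots> = (\<Sum>I\<in>Pow {..<q}. card {c \<in> proper_colorings G q. c ` pverts G = I})"
    proof (rule card_UN_disjoint)
      show "\<forall>I\<in>Pow {..<q}. finite {c \<in> proper_colorings G q. c ` pverts G = I}"
        using fin by (simp add: finite_subset)
    qed auto
    also have "\<dots> = (\<Sum>I\<in>Pow {..<q}. a (card I))"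
      unfolding a_def by (rule sum.cong[OF refl], rule card_proper_colorings_image[OF G]) simp
    also have "\<dots> = (\<Sum>k\<le>q. \<Sum>I\<in>{I \<in> Pow {..<q}. card I = k}. a (card I))"
    proof (rule sum.group[symmetric])
      show "card ` Pow {..<q} \<subseteq> {..q}"
        using card_mono[of "{..<q}"] by auto
    qed simp_all
    also have "\<dots> = (\<Sum>k\<le>q. (q choose k) * a k)"
      using n_subsets[of "{..<q}"] by (intro sum.cong) (auto simp: Pow_def)
    also have "\<dots> = (\<Sum>k\<le>max q ?l. (q choose k) * a k)"
      by (rule sum.mono_neutral_left) auto
    also have "\<dots> = (\<Sum>k\<le>?l. (q choose k) * a k)"
      by (rule sum.mono_neutral_right) (auto simp: a0)
    finally show ?thesis .
  qed
  moreover have "poly f (of_nat q) = of_nat (\<Sum>k\<le>?l. (q choose k) * a k)" for q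
    by (auto simp: f_def poly_sum poly_prod binomial_gbinomial gbinomial_prod_rev atLeast0LessThan
        field_simps intro!: sum.cong)
  ultimately show "\<exists>f. is_chromatic_polynomial G f"
    unfolding is_chromatic_polynomial_def by metis
next
  fix f g assume fg: "is_chromatic_polynomial G f" "is_chromatic_polynomial G g"
  have "infinite ((of_nat :: nat \<Rightarrow> rat) ` {0<..})"
    using infinite_Ioi by (auto simp: finite_image_iff inj_on_def)
  moreover have "of_nat ` {0<..} \<subseteq> {x. poly (f - g) x = 0}"
    using fg by (auto simp: is_chromatic_polynomial_def)
  ultimately have "f - g = 0"
    using poly_roots_finite finite_subset by blast
  then show "f = g" by simp
qed


section \<open>The bond lattice\<close>

text \<open>\<^term>\<open>connected\<close> includes non-emptiness.\<close>
definition connected_subset :: "'a pair_pre_digraph \<Rightarrow> 'a set \<Rightarrow> bool" where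
  "connected_subset G S \<longleftrightarrow> S \<subseteq> pverts G \<and> connected (with_proj G \<restriction> S)"

definition bond_lattice :: "'a pair_pre_digraph \<Rightarrow> 'a set set set" where
  "bond_lattice G = {\<pi>. partition_on (pverts G) \<pi> \<and> (\<forall>S\<in>\<pi>. connected_subset G S)}"

text \<open>The order: \<^term>\<open>refines (pverts G) \<pi>' \<pi>\<close> (\<open>\<pi>'\<close> refines \<open>\<pi>\<close>) is \<open>\<pi> \<ge> \<pi>'\<close>.\<close>
definition bond_less :: "'a pair_pre_digraph \<Rightarrow> 'a set set \<Rightarrow> 'a set set \<Rightarrow> bool" where
  "bond_less G \<pi>' \<pi> \<longleftrightarrow> refines (pverts G) \<pi>' \<pi> \<and> \<pi>' \<noteq> \<pi>"

definition bond_covers :: "'a pair_pre_digraph \<Rightarrow> 'a set set \<Rightarrow> 'a set set \<Rightarrow> bool" where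
  "bond_covers G \<pi> \<pi>' \<longleftrightarrow> \<pi> \<in> bond_lattice G \<and> \<pi>' \<in> bond_lattice G \<and> bond_less G \<pi>' \<pi> \<and>
    \<not> (\<exists>\<sigma>\<in>bond_lattice G. bond_less G \<pi>' \<sigma> \<and> bond_less G \<sigma> \<pi>)"

definition bond_bot :: "'a pair_pre_digraph \<Rightarrow> 'a set set" where
  "bond_bot G = (\<lambda>v. {v}) ` pverts G"

definition bond_digraph :: "'a pair_pre_digraph \<Rightarrow> 'a set set pair_pre_digraph" where
  "bond_digraph G = \<lparr>pverts = bond_lattice G, parcs = {(\<pi>, \<pi>'). bond_covers G \<pi> \<pi>'}\<rparr>"


section \<open>Weights\<close>

definition num_nonsingletons :: "'a set set \<Rightarrow> nat" where
  "num_nonsingletons \<pi> = card {S \<in> \<pi>. card S > 1}"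

definition edges_within :: "'a pair_pre_digraph \<Rightarrow> 'a set \<Rightarrow> nat" where
  "edges_within G S = card {{u, v} | u v. (u, v) \<in> parcs G \<and> u \<in> S \<and> v \<in> S}"

definition edges_between :: "'a pair_pre_digraph \<Rightarrow> 'a set \<Rightarrow> 'a set \<Rightarrow> nat" where
  "edges_between G S T = card {{u, v} | u v. (u, v) \<in> parcs G \<and> u \<in> S \<and> v \<in> T}"

text \<open>
  If \<open>\<pi>\<close> covers \<open>\<pi>'\<close>, then \<open>\<pi>\<close> arises from \<open>\<pi>'\<close> by merging two parts \<open>S\<^sub>1\<close>, \<open>S\<^sub>2\<close> into one
  part \<open>S\<close>. These are determined up to exchanging \<open>S\<^sub>1\<close> and \<open>S\<^sub>2\<close>, which does not affect the
  value; see \<open>edge_weight_eq\<close>.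
\<close>
definition edge_weight :: "'a pair_pre_digraph \<Rightarrow> 'a set set \<Rightarrow> 'a set set \<Rightarrow> rat" where
  "edge_weight G \<pi> \<pi>' = (THE w. \<exists>S S\<^sub>1 S\<^sub>2.
      S \<in> \<pi> \<and> S\<^sub>1 \<in> \<pi>' \<and> S\<^sub>2 \<in> \<pi>' \<and> S\<^sub>1 \<noteq> S\<^sub>2 \<and> S = S\<^sub>1 \<union> S\<^sub>2 \<and> \<pi> - {S} = \<pi>' - {S\<^sub>1, S\<^sub>2} \<and>
      w = 1 / of_nat (num_nonsingletons \<pi>)
        * (of_nat (edges_between G S\<^sub>1 S\<^sub>2) / of_nat (edges_within G S)))"

definition path_weight :: "'a pair_pre_digraph \<Rightarrow> 'a set set vwalk \<Rightarrow> rat" where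
  "path_weight G p = (\<Prod>(\<pi>, \<pi>')\<leftarrow>vwalk_arcs p. edge_weight G \<pi> \<pi>')"

lemma edges_between_commute:
  assumes "pair_graph G"
  shows "edges_between G S T = edges_between G T S"
proof -
  interpret pair_graph G by fact
  have "(v, u) \<in> parcs G" if "(u, v) \<in> parcs G" for u v
    using that pair_sym_arcs by (auto simp: symmetric_def sym_def)
  then show ?thesis
    unfolding edges_between_def by (intro arg_cong[where f = card]) (auto; metis insert_commute)
qed

lemma edge_weight_eq:
  assumes G: "pair_graph G"
    and part: "partition_on (pverts G) \<pi>" "partition_on (pverts G) \<pi>'"
    and S: "S \<in> \<pi>" "S\<^sub>1 \<in> \<pi>'" "S\<^sub>2 \<in> \<pi>'" "S\<^sub>1 \<noteq> S\<^sub>2" "S = S\<^sub>1 \<union> S\<^sub>2"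
    and rest: "\<pi> - {S} = \<pi>' - {S\<^sub>1, S\<^sub>2}"
  shows "edge_weight G \<pi> \<pi>' = 1 / of_nat (num_nonsingletons \<pi>)
      * (of_nat (edges_between G S\<^sub>1 S\<^sub>2) / of_nat (edges_within G S))"
proof -
  have diff: "\<pi> - \<pi>' = {T} \<and> \<pi>' - \<pi> = {T\<^sub>1, T\<^sub>2}"
    if T: "T \<in> \<pi>" "T\<^sub>1 \<in> \<pi>'" "T\<^sub>2 \<in> \<pi>'" "T\<^sub>1 \<noteq> T\<^sub>2" "T = T\<^sub>1 \<union> T\<^sub>2"
      and eq: "\<pi> - {T} = \<pi>' - {T\<^sub>1, T\<^sub>2}" for T T\<^sub>1 T\<^sub>2
  proof -
    have "T\<^sub>1 \<inter> T\<^sub>2 = {}" "T\<^sub>1 \<noteq> {}" "T\<^sub>2 \<noteq> {}"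
      using part(2) T by (auto simp: partition_on_def disjoint_def)
    then have ne: "T \<noteq> T\<^sub>1" "T \<noteq> T\<^sub>2" "T \<inter> T\<^sub>1 \<noteq> {}"
      using T by auto
    then have "T \<notin> \<pi>'"
      using part(2) T(2) by (auto simp: partition_on_def disjoint_def)
    moreover have "T\<^sub>1 \<notin> \<pi>" "T\<^sub>2 \<notin> \<pi>"
      using eq ne by auto
    ultimately show ?thesis
      using eq T by auto
  qed
  note SS = diff[OF S rest]
  show ?thesis
    unfolding edge_weight_def
  proof (rule the_equality)
    show "\<exists>T T\<^sub>1 T\<^sub>2. T \<in> \<pi> \<and> T\<^sub>1 \<in> \<pi>' \<and> T\<^sub>2 \<in> \<pi>' \<and> T\<^sub>1 \<noteq> T\<^sub>2 \<and> T = T\<^sub>1 \<union> T\<^sub>2 \<and>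
        \<pi> - {T} = \<pi>' - {T\<^sub>1, T\<^sub>2} \<and>
        1 / of_nat (num_nonsingletons \<pi>)
          * (of_nat (edges_between G S\<^sub>1 S\<^sub>2) / of_nat (edges_within G S))
        = (1 / of_nat (num_nonsingletons \<pi>)
          * (of_nat (edges_between G T\<^sub>1 T\<^sub>2) / of_nat (edges_within G T)) :: rat)"
      using S rest by blast
  next
    fix w :: rat
    assume "\<exists>T T\<^sub>1 T\<^sub>2. T \<in> \<pi> \<and> T\<^sub>1 \<in> \<pi>' \<and> T\<^sub>2 \<in> \<pi>' \<and> T\<^sub>1 \<noteq> T\<^sub>2 \<and> T = T\<^sub>1 \<union> T\<^sub>2 \<and>
        \<pi> - {T} = \<pi>' - {T\<^sub>1, T\<^sub>2} \<and>
        w = 1 / of_nat (num_nonsingletons \<pi>)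
          * (of_nat (edges_between G T\<^sub>1 T\<^sub>2) / of_nat (edges_within G T))"
    then obtain T T\<^sub>1 T\<^sub>2 where T: "T \<in> \<pi>" "T\<^sub>1 \<in> \<pi>'" "T\<^sub>2 \<in> \<pi>'" "T\<^sub>1 \<noteq> T\<^sub>2" "T = T\<^sub>1 \<union> T\<^sub>2"
        "\<pi> - {T} = \<pi>' - {T\<^sub>1, T\<^sub>2}"
      and w: "w = 1 / of_nat (num_nonsingletons \<pi>)
          * (of_nat (edges_between G T\<^sub>1 T\<^sub>2) / of_nat (edges_within G T))" by blast
    have "T = S" "{T\<^sub>1, T\<^sub>2} = {S\<^sub>1, S\<^sub>2}"
      using diff[OF T] SS by auto
    then have "edges_between G T\<^sub>1 T\<^sub>2 = edges_between G S\<^sub>1 S\<^sub>2"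
      using edges_between_commute[OF G] by (auto simp: doubleton_eq_iff)
    then show "w = 1 / of_nat (num_nonsingletons \<pi>)
        * (of_nat (edges_between G S\<^sub>1 S\<^sub>2) / of_nat (edges_within G S))"
      using w \<open>T = S\<close> by simp
  qed
qed

end

theory Submission
  imports Defs
begin

text \<open>
  For a vertex set \<open>S\<close> let \<open>a(S)\<close> be the sum of \<open>(-1) ^ |A|\<close> over the sets \<open>A\<close> of edges that
  connect \<open>S\<close>. For every edge \<open>uv\<close> inside \<open>S\<close>, \<open>a(S)\<close> is minus the sum of \<open>a(X) a(S - X)\<close> over
  the splittings of \<open>S\<close> that separate \<open>u\<close> from \<open>v\<close>. This identity is used twice. Applied to
  an edge that a colouring \<open>c\<close> makes monochromatic, it shows that the sum of \<open>\<Prod>B\<in>\<pi>. a(B)\<close> over the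
  partitions with \<open>c\<close>-monochromatic blocks is 1 or 0 according to whether \<open>c\<close> is proper; summing over \<open>c\<close>
  yields \<open>\<chi>(G; q) = (\<Sum>\<pi>. (\<Prod>B\<in>\<pi>. a(B)) q ^ |\<pi>|)\<close>. Summed over all edges
  inside \<open>S\<close>, it yields \<open>e(S) a(S) = - (\<Sum>{X, Y}. e(X, Y) a(X) a(Y))\<close> over unordered splittings
  \<open>S = X \<union> Y\<close>. Averaging this over the non-singleton blocks of \<open>\<pi>\<close> shows that \<open>\<Prod>B\<in>\<pi>. a(B)\<close>
  satisfies the recursion of the signed weighted count of paths from \<open>\<pi>\<close> to the bottom.
\<close>


section \<open>Signed sums over connecting edge sets\<close>

text \<open>
  Connectedness of the graph with vertex set \<open>S\<close> and edge set \<open>A\<close>, in the form ``every cut is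
  crossed'', which makes deleting and inserting a single edge easy to analyse.
\<close>
definition spans :: "'a set set \<Rightarrow> 'a set \<Rightarrow> bool" where
  "spans A S \<longleftrightarrow> S \<noteq> {} \<and>
    (\<forall>X. X \<subseteq> S \<longrightarrow> X \<noteq> {} \<longrightarrow> X \<noteq> S \<longrightarrow> (\<exists>x\<in>X. \<exists>y\<in>S - X. {x, y} \<in> A))"

definition inner_edges :: "'a set set \<Rightarrow> 'a set \<Rightarrow> 'a set set" where
  "inner_edges E S = {e \<in> E. e \<subseteq> S}"

text \<open>The linear coefficient of the chromatic polynomial of the graph induced on \<open>S\<close>.\<close>
definition conn_sum :: "'a set set \<Rightarrow> 'a set \<Rightarrow> rat" where
  "conn_sum E S = (\<Sum>A | A \<subseteq> inner_edges E S \<and> spans A S. (-1) ^ card A)"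

section \<open>Cut connectivity and degenerate values of the signed sum\<close>

lemma spans_cut:
  assumes "spans A S" "X \<subseteq> S" "X \<noteq> {}" "X \<noteq> S"
  obtains x y where "x \<in> X" "y \<in> S" "y \<notin> X" "{x, y} \<in> A"
  using assms unfolding spans_def by blast

lemma spans_mono: "spans A S \<Longrightarrow> A \<subseteq> B \<Longrightarrow> spans B S"
  unfolding spans_def by (meson subsetD)

text \<open>Connectivity only grows with the edge set, so a cut left uncrossed by \<open>E\<close>
  is uncrossed by every subset. This later discards partitions with a disconnected block.\<close>

lemma conn_sum_eq_0:
  assumes "\<not> spans E S"
  shows "conn_sum E S = 0"
proof -
  have *: "{A. A \<subseteq> inner_edges E S \<and> spans A S} = {}"
    using assms spans_mono[of _ S E] by (auto simp: inner_edges_def)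
  show ?thesis unfolding conn_sum_def * by simp
qed

text \<open>Edges have two ends, so only the empty edge set contributes. Singleton blocks thus do
  not affect products over blocks.\<close>

lemma conn_sum_singleton:
  assumes "\<And>e. e \<in> E \<Longrightarrow> card e = 2"
  shows "conn_sum E {v} = 1"
proof -
  have "inner_edges E {v} = {}"
    using assms by (fastforce simp: inner_edges_def dest: card_mono[rotated])
  moreover have "spans {} {v}" by (auto simp: spans_def)
  ultimately have *: "{A. A \<subseteq> inner_edges E {v} \<and> spans A {v}} = {{}}" by auto
  show ?thesis unfolding conn_sum_def * by simp
qed

text \<open>A cut of the union cuts \<open>S\<close>, or cuts \<open>T\<close>, or separates the
  two, and in the last case \<open>{u, v}\<close> crosses it. Besides restoring a bridge, this
  serves to merge adjacent blocks of a bond partition.\<close>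

lemma spans_join:
  assumes "spans A S" "spans B T" "u \<in> S" "v \<in> T"
  shows "spans (insert {u, v} (A \<union> B)) (S \<union> T)"
  unfolding spans_def
proof (intro conjI allI impI)
  show "S \<union> T \<noteq> {}" using assms by auto
  fix X assume X: "X \<subseteq> S \<union> T" "X \<noteq> {}" "X \<noteq> S \<union> T"
  let ?C = "insert {u, v} (A \<union> B)"
  consider "X \<inter> S \<noteq> {}" "X \<inter> S \<noteq> S" | "X \<inter> T \<noteq> {}" "X \<inter> T \<noteq> T"
    | "S \<subseteq> X" "X \<inter> T = {}" | "T \<subseteq> X" "X \<inter> S = {}"
    using X by blast
  then show "\<exists>x\<in>X. \<exists>y\<in>S \<union> T - X. {x, y} \<in> ?C"
  proof cases
    case 1
    from spans_cut[OF assms(1) Int_lower2 this] obtain x y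
      where "x \<in> X \<inter> S" "y \<in> S" "y \<notin> X \<inter> S" "{x, y} \<in> A" .
    then show ?thesis by (intro bexI[of _ x] bexI[of _ y]) auto
  next
    case 2
    from spans_cut[OF assms(2) Int_lower2 this] obtain x y
      where "x \<in> X \<inter> T" "y \<in> T" "y \<notin> X \<inter> T" "{x, y} \<in> B" .
    then show ?thesis by (intro bexI[of _ x] bexI[of _ y]) auto
  next
    case 3
    then show ?thesis using assms(3,4) by (intro bexI[of _ u] bexI[of _ v]) auto
  next
    case 4
    then show ?thesis
      using assms(3,4) by (intro bexI[of _ v] bexI[of _ u]) (auto simp: insert_commute)
  qed
qed

text \<open>Of \<open>Y\<close> and \<open>X - Y\<close>, the side missing \<open>u\<close> is
  tested in \<open>S\<close>. It misses \<open>v\<close> as well, so the edge leaving it belongs to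
  \<open>A\<close>; by \<open>cut\<close> that edge stays inside \<open>X\<close> and hence joins
  the two sides.\<close>

lemma spans_side:
  assumes e: "spans (insert {u, v} A) S" and X: "X \<subseteq> S" "u \<in> X" "v \<in> S" "v \<notin> X"
    and cut: "\<And>x y. x \<in> X \<Longrightarrow> y \<in> S - X \<Longrightarrow> {x, y} \<notin> A"
  shows "spans (A \<inter> Pow X) X"
  unfolding spans_def
proof (intro conjI allI impI)
  show "X \<noteq> {}" using X by auto
  fix Y assume Y: "Y \<subseteq> X" "Y \<noteq> {}" "Y \<noteq> X"
  show "\<exists>x\<in>Y. \<exists>y\<in>X - Y. {x, y} \<in> A \<inter> Pow X"
  proof (cases "u \<in> Y")
    case True
    obtain x y where xy: "x \<in> X - Y" "y \<in> S" "y \<notin> X - Y" "{x, y} \<in> insert {u, v} A"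
      by (rule spans_cut[OF e, of "X - Y"]) (use Y X True in auto)
    then have A: "{x, y} \<in> A" using True X by (auto simp: doubleton_eq_iff)
    then have "y \<in> Y" using cut xy by blast
    then show ?thesis using xy Y A by (intro bexI[of _ y] bexI[of _ x]) (auto simp: insert_commute)
  next
    case False
    obtain x y where xy: "x \<in> Y" "y \<in> S" "y \<notin> Y" "{x, y} \<in> insert {u, v} A"
      by (rule spans_cut[OF e, of Y]) (use Y X False in auto)
    then have A: "{x, y} \<in> A" using False X Y by (auto simp: doubleton_eq_iff)
    then have "y \<in> X" using cut xy Y by blast
    then show ?thesis using xy Y A by (intro bexI[of _ y] bexI[of _ x]) auto
  qed
qed

text \<open>A cut left uncrossed by \<open>A\<close> must be crossed by the only new edge
  \<open>{u, v}\<close>, so \<open>spans_side\<close> applies to both of its sides.\<close>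

lemma spans_split:
  assumes A: "A \<subseteq> Pow S" "\<not> spans A S" and e: "spans (insert {u, v} A) S"
    and pairs: "\<And>e. e \<in> A \<Longrightarrow> \<exists>x y. e = {x, y}"
    and uv: "u \<in> S" "v \<in> S"
  obtains X where "X \<subseteq> S" "u \<in> X" "v \<notin> X" "spans (A \<inter> Pow X) X"
    "spans (A \<inter> Pow (S - X)) (S - X)" "A = A \<inter> Pow X \<union> A \<inter> Pow (S - X)"
proof -
  obtain Y where Y: "Y \<subseteq> S" "Y \<noteq> {}" "Y \<noteq> S" and cut: "\<And>x y. x \<in> Y \<Longrightarrow> y \<in> S - Y \<Longrightarrow> {x, y} \<notin> A"
    using A(2) uv unfolding spans_def by auto
  have "u \<in> Y \<longleftrightarrow> v \<notin> Y"
    using spans_cut[OF e Y] cut by (metis DiffI doubleton_eq_iff insertE)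
  define X where "X = (if u \<in> Y then Y else S - Y)"
  have X: "X \<subseteq> S" "u \<in> X" "v \<notin> X" using uv Y \<open>u \<in> Y \<longleftrightarrow> v \<notin> Y\<close> by (auto simp: X_def)
  have cutX: "{x, y} \<notin> A" if "x \<in> X" "y \<in> S - X" for x y
    using that cut[of x y] cut[of y x] by (auto simp: X_def insert_commute split: if_splits)
  show thesis
  proof (rule that[OF X])
    show "spans (A \<inter> Pow X) X" using spans_side[OF e] X uv cutX by blast
    show "spans (A \<inter> Pow (S - X)) (S - X)"
    proof (rule spans_side[of v u])
      show "spans (insert {v, u} A) S" using e by (simp add: insert_commute)
      fix x y assume "x \<in> S - X" "y \<in> S - (S - X)"
      then show "{x, y} \<notin> A" using cutX[of y x] X by (auto simp: insert_commute)
    qed (use X uv in auto)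
    have "e \<subseteq> X \<or> e \<subseteq> S - X" if "e \<in> A" for e
    proof -
      obtain x y where xy: "e = {x, y}" using pairs[OF \<open>e \<in> A\<close>] by blast
      then have "x \<in> S" "y \<in> S" using A that by auto
      then show ?thesis using cutX[of x y] cutX[of y x] that xy by (auto simp: insert_commute)
    qed
    then show "A = A \<inter> Pow X \<union> A \<inter> Pow (S - X)" by blast
  qed
qed

lemma not_spans_Un:
  assumes "A \<subseteq> Pow X" "B \<subseteq> Pow (S - X)" "X \<subseteq> S" "X \<noteq> {}" "X \<noteq> S"
  shows "\<not> spans (A \<union> B) S"
  using assms by (auto elim!: spans_cut[of "A \<union> B" S X])

text \<open>An edge of \<open>A\<close> leading from \<open>X \<inter> X'\<close> to the rest of
  \<open>X\<close> would lie neither inside \<open>X'\<close> nor inside its complement. Used in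
  both directions, this recovers the side of \<open>u\<close> from the union: it is the component of
  \<open>u\<close>.\<close>

lemma spans_Un_eq:
  assumes A: "A \<subseteq> Pow X" "B \<subseteq> Pow (S - X)" "spans A X"
    and A': "A' \<subseteq> Pow X'" "B' \<subseteq> Pow (S - X')"
    and eq: "A \<union> B = A' \<union> B'" and u: "u \<in> X" "u \<in> X'"
  shows "X \<subseteq> X'"
proof (rule ccontr)
  assume "\<not> X \<subseteq> X'"
  then have "X \<inter> X' \<noteq> {}" "X \<inter> X' \<noteq> X" using u by auto
  from spans_cut[OF A(3) Int_lower1 this]
  obtain x y where xy: "x \<in> X \<inter> X'" "y \<in> X" "y \<notin> X \<inter> X'" "{x, y} \<in> A" .
  then have "{x, y} \<in> A' \<union> B'" using eq by auto
  then show False using A' xy by auto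
qed

text \<open>An edge set that \<open>{u, v}\<close> would connect as a bridge is encoded by the
  component of \<open>u\<close> and the edges on either side. This factors the uncancelled terms of
  \<open>conn_sum\<close> into two independent sums.\<close>

lemma bij_betw_spans_split:
  fixes E :: "'a set set"
  assumes card2: "\<And>e. e \<in> E \<Longrightarrow> card e = 2"
    and uv: "u \<in> S" "v \<in> S"
  shows "bij_betw (\<lambda>(X, A, B). A \<union> B)
    (SIGMA X:{X. X \<subseteq> S \<and> u \<in> X \<and> v \<notin> X}.
      {A. A \<subseteq> inner_edges E X \<and> spans A X} \<times>
      {A. A \<subseteq> inner_edges E (S - X) \<and> spans A (S - X)})
    {A. A \<subseteq> inner_edges E S - {{u, v}} \<and> \<not> spans A S \<and> spans (insert {u, v} A) S}"
    (is "bij_betw ?h ?T ?C")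
proof -
  have T: "A \<subseteq> Pow X" "B \<subseteq> Pow (S - X)" "X \<subseteq> S" "X \<noteq> {}" "X \<noteq> S" "spans A X" "spans B (S - X)"
    "u \<in> X" "v \<in> S - X" "A \<subseteq> E" "B \<subseteq> E"
    if "(X, A, B) \<in> ?T" for X A B
    using that uv by (auto simp: inner_edges_def)
  have ne: "{} \<notin> E" using card2 by fastforce
  \<comment> \<open>The two power sets share only \<open>{}\<close>, which is not an edge, so the
    union determines both edge sets once \<open>X\<close> is known.\<close>
  have parts: "A = (A \<union> B) \<inter> Pow X" "B = (A \<union> B) \<inter> Pow (S - X)"
    if "A \<subseteq> Pow X" "B \<subseteq> Pow (S - X)" "A \<subseteq> E" "B \<subseteq> E" for X A B
  proof -
    have dj: "Pow X \<inter> Pow (S - X) = {{}}" by auto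
    have "A \<inter> Pow (S - X) \<subseteq> {{}}" "B \<inter> Pow X \<subseteq> {{}}"
      unfolding dj[symmetric] using that(1,2) by auto
    moreover have "{} \<notin> A" "{} \<notin> B" using that(3,4) ne by auto
    ultimately have "A \<inter> Pow (S - X) = {}" "B \<inter> Pow X = {}" by auto
    then show "A = (A \<union> B) \<inter> Pow X" "B = (A \<union> B) \<inter> Pow (S - X)"
      using that(1,2) by (simp_all add: Int_Un_distrib2 Int_absorb2)
  qed
  have "inj_on ?h ?T"
  proof (rule inj_onI)
    fix p p' assume p: "p \<in> ?T" "p' \<in> ?T" "?h p = ?h p'"
    obtain X A B X' A' B' where pp: "p = (X, A, B)" "p' = (X', A', B')"
      by (metis prod_cases3)
    have t: "(X, A, B) \<in> ?T" "(X', A', B') \<in> ?T" and eq: "A \<union> B = A' \<union> B'"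
      using p unfolding pp by simp_all
    note t1 = T[OF t(1)] and t2 = T[OF t(2)]
    have X: "X = X'"
      using spans_Un_eq[OF t1(1,2,6) t2(1,2) eq t1(8) t2(8)]
        spans_Un_eq[OF t2(1,2,6) t1(1,2) eq[symmetric] t2(8) t1(8)] by blast
    then show "p = p'"
      unfolding pp using parts[OF t1(1,2,10,11)] parts[OF t2(1,2,10,11)] eq by simp
  qed
  moreover have "?h ` ?T = ?C"
  proof (intro equalityI subsetI)
    fix C assume "C \<in> ?h ` ?T"
    then obtain X A B where t: "(X, A, B) \<in> ?T" and C: "C = A \<union> B" by auto
    note t1 = T[OF t]
    have "X \<union> (S - X) = S" using t1 by auto
    then have "spans (insert {u, v} C) S" using spans_join[OF t1(6,7,8,9)] C by simp
    moreover have "C \<subseteq> inner_edges E S - {{u, v}}"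
      using t1 unfolding C inner_edges_def by auto
    ultimately show "C \<in> ?C"
      using not_spans_Un[OF t1(1-5)] C by simp
  next
    fix C assume C: "C \<in> ?C"
    then have CE: "C \<subseteq> E" "C \<subseteq> Pow S" by (auto simp: inner_edges_def)
    have "\<exists>x y. e = {x, y}" if "e \<in> C" for e
      using card2[of e] that CE by (auto simp: card_2_iff)
    then obtain X where X: "X \<subseteq> S" "u \<in> X" "v \<notin> X" "spans (C \<inter> Pow X) X"
        "spans (C \<inter> Pow (S - X)) (S - X)" "C = C \<inter> Pow X \<union> C \<inter> Pow (S - X)"
      using spans_split[OF CE(2) _ _ _ uv] C by blast
    then have "(X, C \<inter> Pow X, C \<inter> Pow (S - X)) \<in> ?T"
      using CE by (auto simp: inner_edges_def)
    then show "C \<in> ?h ` ?T" using X(6) by (intro image_eqI[of _ _ "(X, C \<inter> Pow X, C \<inter> Pow (S - X))"]) auto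
  qed
  ultimately show ?thesis by (simp add: bij_betw_def)
qed

text \<open>
  Toggling \<open>{u, v}\<close> cancels all terms except the \<open>A\<close> in which this edge is a bridge; removing it
  leaves a connected graph on a part \<open>X\<close> containing \<open>u\<close> and one on the complement.
\<close>
lemma conn_sum_edge:
  fixes E :: "'a set set"
  assumes S: "finite S" and card2: "\<And>e. e \<in> E \<Longrightarrow> card e = 2"
    and uv: "u \<in> S" "v \<in> S" "{u, v} \<in> E"
  shows "conn_sum E S = - (\<Sum>X | X \<subseteq> S \<and> u \<in> X \<and> v \<notin> X. conn_sum E X * conn_sum E (S - X))"
proof -
  let ?e = "{u, v}"
  have fin_in: "finite (inner_edges E T)" if "T \<subseteq> S" for T
    by (rule finite_subset[of _ "Pow S"]) (use that S in \<open>auto simp: inner_edges_def\<close>)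
  define P where "P = Pow (inner_edges E S - {?e})"
  \<comment> \<open>Extension by zero lets the sum run over a full power set, which splits evenly by
    membership of the edge.\<close>
  define f where "f A = (if spans A S then (-1) ^ card A else 0 :: rat)" for A
  have finP: "finite P" using fin_in by (simp add: P_def)
  have Pow_eq: "Pow (inner_edges E S) = P \<union> insert ?e ` P"
    using Pow_insert[of ?e "inner_edges E S - {?e}"] uv
    by (simp add: P_def inner_edges_def insert_absorb)
  have e_notin: "?e \<notin> A" "finite A" if "A \<in> P" for A
    using that fin_in[of S] by (auto simp: P_def intro: finite_subset)
  have inj: "inj_on (insert ?e) P"
    using e_notin(1) by (intro inj_onI) (metis insert_ident)
  have "conn_sum E S = sum f (Pow (inner_edges E S))"
    unfolding conn_sum_def f_def using fin_in by (subst sum.inter_filter[symmetric]) (auto simp: Pow_def)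
  also have "\<dots> = sum f P + sum f (insert ?e ` P)"
    unfolding Pow_eq using finP e_notin(1) by (intro sum.union_disjoint) auto
  also have "sum f (insert ?e ` P) = (\<Sum>A\<in>P. f (insert ?e A))"
    using inj by (simp add: sum.reindex)
  also have "sum f P + \<dots> = (\<Sum>A\<in>P. f A + f (insert ?e A))"
    by (simp add: sum.distrib)
  also have "\<dots> = (\<Sum>A\<in>P. if \<not> spans A S \<and> spans (insert ?e A) S then - ((-1) ^ card A) else 0)"
  proof (rule sum.cong[OF refl])
    fix A assume "A \<in> P"
    then show "f A + f (insert ?e A)
        = (if \<not> spans A S \<and> spans (insert ?e A) S then - ((-1) ^ card A) else 0)"
      using e_notin[of A] spans_mono[of A S "insert ?e A"] by (auto simp: f_def)
  qed
  also have "\<dots> = - (\<Sum>A | A \<in> P \<and> \<not> spans A S \<and> spans (insert ?e A) S. (-1) ^ card A)"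
    using finP by (subst sum.inter_filter[symmetric]) (simp_all add: sum_negf)
  also have "(\<Sum>A | A \<in> P \<and> \<not> spans A S \<and> spans (insert ?e A) S. (-1) ^ card A :: rat)
    = (\<Sum>(X, A, B) \<in> (SIGMA X:{X. X \<subseteq> S \<and> u \<in> X \<and> v \<notin> X}.
          {A. A \<subseteq> inner_edges E X \<and> spans A X} \<times>
          {A. A \<subseteq> inner_edges E (S - X) \<and> spans A (S - X)}).
        (-1) ^ card (A \<union> B))" (is "_ = sum _ ?T")
    unfolding P_def Pow_iff
    using sum.reindex_bij_betw[OF bij_betw_spans_split[OF card2 uv(1,2)],
        where g = "\<lambda>A. (-1) ^ card A :: rat"]
    by (simp add: split_def)
  also have "\<dots> = (\<Sum>(X, A, B)\<in>?T. (-1) ^ card A * (-1) ^ card B)"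
  proof (rule sum.cong[OF refl], clarify)
    fix X A B
    assume *: "X \<subseteq> S" "A \<subseteq> inner_edges E X" "B \<subseteq> inner_edges E (S - X)"
    have "{} \<notin> E" using card2 by fastforce
    moreover have "b = {}" if "b \<in> A" "b \<in> B" for b
    proof -
      have "b \<subseteq> X" "b \<subseteq> S - X" using * that by (auto simp: inner_edges_def)
      then show ?thesis by auto
    qed
    ultimately have "A \<inter> B = {}" using *(2) by (auto simp: inner_edges_def)
    moreover have "finite A" "finite B"
      using * fin_in[of X] fin_in[of "S - X"] by (auto intro: finite_subset)
    ultimately show "(-1) ^ card (A \<union> B) = (-1) ^ card A * ((-1) ^ card B :: rat)"
      by (simp add: card_Un_disjoint power_add)
  qed
  also have "\<dots> = (\<Sum>X | X \<subseteq> S \<and> u \<in> X \<and> v \<notin> X. conn_sum E X * conn_sum E (S - X))"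
    unfolding conn_sum_def sum_product sum.cartesian_product
    using S fin_in by (subst sum.Sigma) (auto simp: split_def)
  finally show ?thesis .
qed


section \<open>Sums over set partitions and colorings\<close>

definition part_sum :: "('a set \<Rightarrow> rat) \<Rightarrow> 'a set \<Rightarrow> rat" where
  "part_sum a V = (\<Sum>\<pi> | partition_on V \<pi>. \<Prod>B\<in>\<pi>. a B)"

section \<open>Peeling one block off a set partition\<close>

lemma partition_on_insert_block:
  assumes "partition_on (V - B) \<rho>" "B \<subseteq> V" "B \<noteq> {}"
  shows "partition_on V (insert B \<rho>)" "B \<notin> \<rho>"
  using assms by (auto simp: partition_on_def disjoint_def)

lemma partition_on_remove_block:
  assumes "partition_on V \<pi>" "B \<in> \<pi>"
  shows "partition_on (V - B) (\<pi> - {B})"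
  using assms by (fastforce simp: partition_on_def disjoint_def)

text \<open>Exactly one block contains \<open>u\<close>; removing it leaves an arbitrary partition
  of the remaining points.\<close>

lemma part_sum_block:
  assumes V: "finite V" and u: "u \<in> V"
  shows "part_sum a V = (\<Sum>B | B \<subseteq> V \<and> u \<in> B. a B * part_sum a (V - B))"
proof -
  let ?T = "SIGMA B:{B. B \<subseteq> V \<and> u \<in> B}. {\<rho>. partition_on (V - B) \<rho>}"
  have "bij_betw (\<lambda>(B, \<rho>). insert B \<rho>) ?T {\<pi>. partition_on V \<pi>}"
    unfolding bij_betw_def
  proof
    show "inj_on (\<lambda>(B, \<rho>). insert B \<rho>) ?T"
    proof (rule inj_onI)
      fix p p' assume p: "p \<in> ?T" "p' \<in> ?T" "(\<lambda>(B, \<rho>). insert B \<rho>) p = (\<lambda>(B, \<rho>). insert B \<rho>) p'"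
      obtain B \<rho> B' \<rho>' where pp: "p = (B, \<rho>)" "p' = (B', \<rho>')"
        by (metis surj_pair)
      have t: "B \<subseteq> V" "u \<in> B" "partition_on (V - B) \<rho>" "B' \<subseteq> V" "u \<in> B'" "partition_on (V - B') \<rho>'"
        and eq: "insert B \<rho> = insert B' \<rho>'"
        using p unfolding pp by auto
      \<comment> \<open>The block \<open>B\<close> contains \<open>u\<close>, so it cannot belong to
        \<open>\<rho>'\<close> and must be \<open>B'\<close>.\<close>
      have "u \<notin> \<Union>\<rho>'" using t partition_onD1[OF t(6)] by auto
      then have "B = B'" using eq t(2) by blast
      moreover have "B \<notin> \<rho>" "B' \<notin> \<rho>'" using t by (auto dest: partition_on_insert_block)
      ultimately show "p = p'" unfolding pp using eq by (simp add: insert_ident)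
    qed
    show "(\<lambda>(B, \<rho>). insert B \<rho>) ` ?T = {\<pi>. partition_on V \<pi>}"
    proof (intro equalityI subsetI)
      fix \<pi> assume "\<pi> \<in> (\<lambda>(B, \<rho>). insert B \<rho>) ` ?T"
      then show "\<pi> \<in> {\<pi>. partition_on V \<pi>}" by (auto intro: partition_on_insert_block)
    next
      fix \<pi> assume "\<pi> \<in> {\<pi>. partition_on V \<pi>}"
      then have \<pi>: "partition_on V \<pi>" by simp
      then obtain B where B: "B \<in> \<pi>" "u \<in> B" using u partition_onD1 by blast
      then have "(B, \<pi> - {B}) \<in> ?T"
        using partition_on_remove_block[OF \<pi>] partition_onD1[OF \<pi>] by auto
      then show "\<pi> \<in> (\<lambda>(B, \<rho>). insert B \<rho>) ` ?T"
        using B by (intro image_eqI[of _ _ "(B, \<pi> - {B})"]) auto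
    qed
  qed
  from sum.reindex_bij_betw[OF this, of "prod a"]
  have "part_sum a V = (\<Sum>(B, \<rho>)\<in>?T. prod a (insert B \<rho>))"
    by (simp add: part_sum_def split_def)
  also have "\<dots> = (\<Sum>(B, \<rho>)\<in>?T. a B * prod a \<rho>)"
  proof (rule sum.cong[OF refl], clarify)
    fix B \<rho> assume *: "B \<subseteq> V" "u \<in> B" "partition_on (V - B) \<rho>"
    then have "finite \<rho>" "B \<notin> \<rho>"
      using finite_elements[of "V - B"] V partition_on_insert_block(2) by blast+
    then show "prod a (insert B \<rho>) = a B * prod a \<rho>" by simp
  qed
  also have "\<dots> = (\<Sum>B | B \<subseteq> V \<and> u \<in> B. a B * part_sum a (V - B))"
    unfolding part_sum_def sum_distrib_left
    using V by (subst sum.Sigma) (auto simp: finitely_many_partition_on)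
  finally show ?thesis .
qed

text \<open>
  Partitions with \<open>u\<close>, \<open>v\<close> in one block \<open>B\<close> cancel against those obtained by splitting \<open>B\<close> so as
  to separate \<open>u\<close> from \<open>v\<close>.
\<close>
lemma part_sum_eq_0:
  assumes V: "finite V" and uv: "u \<in> V" "v \<in> V"
    and a: "\<And>B. B \<subseteq> V \<Longrightarrow> u \<in> B \<Longrightarrow> v \<in> B \<Longrightarrow>
      a B = - (\<Sum>X | X \<subseteq> B \<and> u \<in> X \<and> v \<notin> X. a X * a (B - X))"
  shows "part_sum a V = 0"
proof -
  have split: "{B. B \<subseteq> V \<and> u \<in> B} = {B. B \<subseteq> V \<and> u \<in> B \<and> v \<in> B} \<union> {B. B \<subseteq> V \<and> u \<in> B \<and> v \<notin> B}"
    by auto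
  \<comment> \<open>\<open>?S\<close> records a common block of \<open>u\<close> and
    \<open>v\<close> with the part \<open>X\<close> split off around \<open>u\<close>;
    \<open>?T\<close> records the two separate blocks of \<open>u\<close> and \<open>v\<close>.
    Uniting the two blocks, or splitting the common one, translates between them.\<close>
  let ?S = "SIGMA B:{B. B \<subseteq> V \<and> u \<in> B \<and> v \<in> B}. {X. X \<subseteq> B \<and> u \<in> X \<and> v \<notin> X}"
  let ?T = "SIGMA B:{B. B \<subseteq> V \<and> u \<in> B \<and> v \<notin> B}. {C. C \<subseteq> V - B \<and> v \<in> C}"
  have "(\<Sum>B | B \<subseteq> V \<and> u \<in> B \<and> v \<notin> B. a B * part_sum a (V - B))
      = (\<Sum>B | B \<subseteq> V \<and> u \<in> B \<and> v \<notin> B. \<Sum>C | C \<subseteq> V - B \<and> v \<in> C.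
          a B * (a C * part_sum a (V - B - C)))"
  proof (rule sum.cong[OF refl], clarify)
    fix B assume "B \<subseteq> V" "u \<in> B" "v \<notin> B"
    then show "a B * part_sum a (V - B)
        = (\<Sum>C | C \<subseteq> V - B \<and> v \<in> C. a B * (a C * part_sum a (V - B - C)))"
      using V uv by (subst part_sum_block[of "V - B" v]) (auto simp: sum_distrib_left)
  qed
  also have "\<dots> = (\<Sum>(B, C)\<in>?T. a B * (a C * part_sum a (V - B - C)))"
    using V by (intro sum.Sigma) auto
  also have "\<dots> = (\<Sum>(B, X)\<in>?S. a X * (a (B - X) * part_sum a (V - B)))"
  proof (rule sum.reindex_bij_witness[where i = "\<lambda>(B, X). (X, B - X)" and j = "\<lambda>(X, C). (X \<union> C, X)"])
    fix p assume "p \<in> ?T"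
    then obtain X C where p: "p = (X, C)" "X \<inter> C = {}" by auto
    then have "X \<union> C - X = C" "V - (X \<union> C) = V - X - C" by auto
    then show "(case case p of (X, C) \<Rightarrow> (X \<union> C, X) of
        (B, X) \<Rightarrow> a X * (a (B - X) * part_sum a (V - B))) =
      (case p of (B, C) \<Rightarrow> a B * (a C * part_sum a (V - B - C)))"
      by (simp add: p)
  qed auto
  also have "\<dots> = (\<Sum>B | B \<subseteq> V \<and> u \<in> B \<and> v \<in> B.
      \<Sum>X | X \<subseteq> B \<and> u \<in> X \<and> v \<notin> X. a X * (a (B - X) * part_sum a (V - B)))"
  proof (intro sum.Sigma[symmetric] ballI)
    fix B assume "B \<in> {B. B \<subseteq> V \<and> u \<in> B \<and> v \<in> B}"
    then have "finite B" using V finite_subset by blast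
    then show "finite {X. X \<subseteq> B \<and> u \<in> X \<and> v \<notin> X}" by simp
  qed (use V in simp)
  also have "\<dots> = (\<Sum>B | B \<subseteq> V \<and> u \<in> B \<and> v \<in> B. - (a B * part_sum a (V - B)))"
  proof (rule sum.cong[OF refl], clarify)
    fix B assume "B \<subseteq> V" "u \<in> B" "v \<in> B"
    then show "(\<Sum>X | X \<subseteq> B \<and> u \<in> X \<and> v \<notin> X. a X * (a (B - X) * part_sum a (V - B)))
        = - (a B * part_sum a (V - B))"
      by (subst (2) a) (simp_all add: sum_distrib_right mult.assoc)
  qed
  finally have cancel: "(\<Sum>B | B \<subseteq> V \<and> u \<in> B \<and> v \<notin> B. a B * part_sum a (V - B))
    = - (\<Sum>B | B \<subseteq> V \<and> u \<in> B \<and> v \<in> B. a B * part_sum a (V - B))"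
    by (simp add: sum_negf)
  have "part_sum a V = (\<Sum>B | B \<subseteq> V \<and> u \<in> B \<and> v \<in> B. a B * part_sum a (V - B))
      + (\<Sum>B | B \<subseteq> V \<and> u \<in> B \<and> v \<notin> B. a B * part_sum a (V - B))"
    unfolding part_sum_block[OF V uv(1)] split using V by (intro sum.union_disjoint) auto
  then show ?thesis using cancel by simp
qed

section \<open>Colorings that are constant on blocks\<close>

definition monochromatic :: "('a \<Rightarrow> 'b) \<Rightarrow> 'a set \<Rightarrow> bool" where
  "monochromatic c B \<longleftrightarrow> (\<exists>k. \<forall>x\<in>B. c x = k)"

lemma monochromaticD: "monochromatic c B \<Longrightarrow> x \<in> B \<Longrightarrow> y \<in> B \<Longrightarrow> c x = c y"
  unfolding monochromatic_def by metis

lemma monochromatic_subset: "monochromatic c B \<Longrightarrow> X \<subseteq> B \<Longrightarrow> monochromatic c X"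
  unfolding monochromatic_def by blast

lemma monochromatic_Un:
  assumes "monochromatic c X" "monochromatic c Y" "u \<in> X" "v \<in> Y" "c u = c v"
  shows "monochromatic c (X \<union> Y)"
proof -
  obtain k l where "\<forall>x\<in>X. c x = k" "\<forall>x\<in>Y. c x = l"
    using assms unfolding monochromatic_def by blast
  then have "\<forall>x\<in>X \<union> Y. c x = k" using assms(3-5) by auto
  then show ?thesis unfolding monochromatic_def by blast
qed

text \<open>If \<open>c\<close> gives both ends of an edge the same color, the truncated weights
  inherit the recursion \<open>conn_sum_edge\<close> at that edge, and \<open>part_sum_eq_0\<close>
  applies. If \<open>c\<close> is proper, a connected block with two vertices is never
  monochromatic, so only the partition into singletons survives.\<close>

lemma part_sum_monochromatic:
  assumes V: "finite V" and card2: "\<And>e. e \<in> E \<Longrightarrow> card e = 2"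
  shows "part_sum (\<lambda>B. if monochromatic c B then conn_sum E B else 0) V
    = of_bool (\<forall>u\<in>V. \<forall>v\<in>V. {u, v} \<in> E \<longrightarrow> c u \<noteq> c v)"
    (is "part_sum ?a V = _")
proof (cases "\<forall>u\<in>V. \<forall>v\<in>V. {u, v} \<in> E \<longrightarrow> c u \<noteq> c v")
  case False
  then obtain u v where uv: "u \<in> V" "v \<in> V" "{u, v} \<in> E" "c u = c v" by auto
  have "part_sum ?a V = 0"
  proof (rule part_sum_eq_0[OF V uv(1,2)])
    fix B assume B: "B \<subseteq> V" "u \<in> B" "v \<in> B"
    have "?a X * ?a (B - X)
        = (if monochromatic c B then conn_sum E X * conn_sum E (B - X) else 0)"
      if X: "X \<subseteq> B" "u \<in> X" "v \<notin> X" for X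
    proof -
      \<comment> \<open>Gluing the parts relies on \<open>c u = c v\<close>, with one vertex in each
        part.\<close>
      have "monochromatic c X \<and> monochromatic c (B - X) \<longleftrightarrow> monochromatic c B"
        using X B uv(4) monochromatic_Un[of c X "B - X" u v]
          monochromatic_subset[of c B X] monochromatic_subset[of c B "B - X"]
        by (metis DiffI Diff_partition Diff_subset)
      then show ?thesis by auto
    qed
    then have "(\<Sum>X | X \<subseteq> B \<and> u \<in> X \<and> v \<notin> X. ?a X * ?a (B - X))
      = (\<Sum>X | X \<subseteq> B \<and> u \<in> X \<and> v \<notin> X.
          if monochromatic c B then conn_sum E X * conn_sum E (B - X) else 0)"
      by (intro sum.cong) auto
    moreover have "conn_sum E B = - (\<Sum>X | X \<subseteq> B \<and> u \<in> X \<and> v \<notin> X. conn_sum E X * conn_sum E (B - X))"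
      using conn_sum_edge[of B E u v] card2 B V uv(3) finite_subset by blast
    ultimately show "?a B = - (\<Sum>X | X \<subseteq> B \<and> u \<in> X \<and> v \<notin> X. ?a X * ?a (B - X))"
      by auto
  qed
  then show ?thesis using False by simp
next
  case True
  let ?bot = "(\<lambda>x. {x}) ` V"
  have "prod ?a \<pi> = 0" if \<pi>: "partition_on V \<pi>" "\<pi> \<noteq> ?bot" for \<pi>
  proof -
    obtain B where B: "B \<in> \<pi>" "\<And>x. B \<noteq> {x}"
    proof (rule ccontr)
      assume "\<not> thesis"
      then have s: "\<And>B. B \<in> \<pi> \<Longrightarrow> \<exists>x. B = {x}" using that by blast
      have "\<pi> = ?bot"
      proof (intro equalityI subsetI)
        fix B assume "B \<in> \<pi>"
        then show "B \<in> ?bot" using s[of B] partition_onD1[OF \<pi>(1)] by auto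
      next
        fix B assume "B \<in> ?bot"
        then obtain x where x: "x \<in> V" "B = {x}" by auto
        then obtain C where "C \<in> \<pi>" "x \<in> C" using partition_onD1[OF \<pi>(1)] by auto
        then show "B \<in> \<pi>" using s[of C] x by auto
      qed
      then show False using \<pi>(2) by simp
    qed
    have BV: "B \<subseteq> V" "B \<noteq> {}" using B \<pi>(1) by (auto simp: partition_on_def)
    then obtain x where x: "x \<in> B" by auto
    have "?a B = 0"
    proof (cases "spans E B")
      case sp: True
      \<comment> \<open>In a connected block the cut \<open>{x}\<close> is crossed by an edge, whose
        ends a proper coloring distinguishes.\<close>
      from x B(2)[of x] spans_cut[OF sp, of "{x}"]
      obtain y where "y \<in> B" "{x, y} \<in> E" by auto
      then have "c x \<noteq> c y" using True BV x by blast
      then show ?thesis using \<open>y \<in> B\<close> x monochromaticD[of c B x y] by auto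
    qed (simp add: conn_sum_eq_0)
    then show ?thesis using B(1) finite_elements[OF V \<pi>(1)] by (intro prod_zero) blast+
  qed
  then have "part_sum ?a V = (\<Sum>\<pi>\<in>{?bot}. prod ?a \<pi>)"
    unfolding part_sum_def using V
    by (intro sum.mono_neutral_right) (auto simp: finitely_many_partition_on partition_on_singletons)
  also have "\<dots> = (\<Prod>x\<in>V. ?a {x})"
    by (simp add: prod.reindex)
  also have "\<dots> = 1"
    using conn_sum_singleton[of E] card2 by (simp add: monochromatic_def)
  finally show ?thesis using True by simp
qed

text \<open>Such a coloring amounts to one free choice of color per block.\<close>

lemma card_monochromatic_blocks:
  fixes q :: nat
  assumes V: "finite V" and \<pi>: "partition_on V \<pi>"
  shows "card {c \<in> V \<rightarrow>\<^sub>E {..<q}. \<forall>B\<in>\<pi>. monochromatic c B} = q ^ card \<pi>"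
proof -
  have fin: "finite \<pi>" using finite_elements[OF V \<pi>] .
  \<comment> \<open>\<open>blk\<close> and \<open>rep\<close> provide the two inverse translations
    between coloring vertices and coloring blocks; \<open>blk\<close> is well defined on
    \<open>V\<close> by disjointness.\<close>
  define blk where "blk x = (THE B. B \<in> \<pi> \<and> x \<in> B)" for x
  define rep where "rep B = (SOME x. x \<in> B)" for B :: "'a set"
  have blk: "blk x = B" if "x \<in> B" "B \<in> \<pi>" for x B
    unfolding blk_def using that partition_onD2[OF \<pi>]
    by (intro the_equality) (auto simp: disjoint_def)
  have blk_in: "blk x \<in> \<pi>" if "x \<in> V" for x
    using that blk partition_onD1[OF \<pi>] by auto
  have rep: "rep B \<in> B" if "B \<in> \<pi>" for B
    unfolding rep_def using that partition_onD3[OF \<pi>] by (metis some_in_eq)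
  have repV: "rep B \<in> V" if "B \<in> \<pi>" for B
    using rep[OF that] that partition_onD1[OF \<pi>] by auto
  have "bij_betw (\<lambda>f. restrict (\<lambda>x. f (blk x)) V) (\<pi> \<rightarrow>\<^sub>E {..<q})
      {c \<in> V \<rightarrow>\<^sub>E {..<q}. \<forall>B\<in>\<pi>. monochromatic c B}"
  proof (rule bij_betw_byWitness[where f' = "\<lambda>c. restrict (\<lambda>B. c (rep B)) \<pi>"])
    show "\<forall>f\<in>\<pi> \<rightarrow>\<^sub>E {..<q}. restrict (\<lambda>B. restrict (\<lambda>x. f (blk x)) V (rep B)) \<pi> = f"
    proof
      fix f assume "f \<in> \<pi> \<rightarrow>\<^sub>E {..<q}"
      then show "restrict (\<lambda>B. restrict (\<lambda>x. f (blk x)) V (rep B)) \<pi> = f"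
        using blk[OF rep] repV by (auto simp: fun_eq_iff restrict_def PiE_def extensional_def)
    qed
    show "\<forall>c\<in>{c \<in> V \<rightarrow>\<^sub>E {..<q}. \<forall>B\<in>\<pi>. monochromatic c B}.
        restrict (\<lambda>x. restrict (\<lambda>B. c (rep B)) \<pi> (blk x)) V = c"
    proof clarify
      fix c assume c: "c \<in> V \<rightarrow>\<^sub>E {..<q}" "\<forall>B\<in>\<pi>. monochromatic c B"
      have "c (rep (blk x)) = c x" if x: "x \<in> V" for x
      proof -
        obtain B where "B \<in> \<pi>" "x \<in> B" using x partition_onD1[OF \<pi>] by auto
        then show ?thesis using c(2) rep[of B] blk[of x B] monochromaticD[of c B "rep B" x] by simp
      qed
      then show "restrict (\<lambda>x. restrict (\<lambda>B. c (rep B)) \<pi> (blk x)) V = c"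
        using c(1) blk_in by (auto simp: fun_eq_iff restrict_def PiE_def extensional_def)
    qed
    show "(\<lambda>f. restrict (\<lambda>x. f (blk x)) V) ` (\<pi> \<rightarrow>\<^sub>E {..<q})
        \<subseteq> {c \<in> V \<rightarrow>\<^sub>E {..<q}. \<forall>B\<in>\<pi>. monochromatic c B}"
    proof clarify
      fix f assume f: "f \<in> \<pi> \<rightarrow>\<^sub>E {..<q}"
      have "restrict (\<lambda>x. f (blk x)) V x = f B" if "B \<in> \<pi>" "x \<in> B" for B x
        using blk[OF that(2,1)] that partition_onD1[OF \<pi>] by auto
      then have "\<forall>B\<in>\<pi>. monochromatic (restrict (\<lambda>x. f (blk x)) V) B"
        unfolding monochromatic_def by blast
      moreover have "restrict (\<lambda>x. f (blk x)) V \<in> V \<rightarrow>\<^sub>E {..<q}" using f blk_in by auto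
      ultimately show "restrict (\<lambda>x. f (blk x)) V \<in> V \<rightarrow>\<^sub>E {..<q} \<and>
        (\<forall>B\<in>\<pi>. monochromatic (restrict (\<lambda>x. f (blk x)) V) B)" by simp
    qed
    show "(\<lambda>c. restrict (\<lambda>B. c (rep B)) \<pi>) ` {c \<in> V \<rightarrow>\<^sub>E {..<q}. \<forall>B\<in>\<pi>. monochromatic c B}
        \<subseteq> \<pi> \<rightarrow>\<^sub>E {..<q}"
      using repV by auto
  qed
  then have "card {c \<in> V \<rightarrow>\<^sub>E {..<q}. \<forall>B\<in>\<pi>. monochromatic c B} = card (\<pi> \<rightarrow>\<^sub>E {..<q})"
    by (rule bij_betw_same_card[symmetric])
  then show ?thesis using fin by (simp add: card_PiE)
qed

text \<open>The indicator of properness is expanded over partitions by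
  \<open>part_sum_monochromatic\<close>. After exchanging the sums, each partition is weighted by
  the number of colorings constant on its blocks.\<close>

lemma card_colorings_part_sum:
  fixes q :: nat
  assumes V: "finite V" and card2: "\<And>e. e \<in> E \<Longrightarrow> card e = 2"
  shows "of_nat (card {c \<in> V \<rightarrow>\<^sub>E {..<q}. \<forall>u\<in>V. \<forall>v\<in>V. {u, v} \<in> E \<longrightarrow> c u \<noteq> c v})
    = (\<Sum>\<pi> | partition_on V \<pi>. (\<Prod>B\<in>\<pi>. conn_sum E B) * of_nat q ^ card \<pi>)"
proof -
  have fin: "finite (V \<rightarrow>\<^sub>E {..<q})" using V by (simp add: finite_PiE)
  let ?P = "{\<pi>. partition_on V \<pi>}"
  have "of_nat (card {c \<in> V \<rightarrow>\<^sub>E {..<q}. \<forall>u\<in>V. \<forall>v\<in>V. {u, v} \<in> E \<longrightarrow> c u \<noteq> c v})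
    = (\<Sum>c\<in>V \<rightarrow>\<^sub>E {..<q}. of_bool (\<forall>u\<in>V. \<forall>v\<in>V. {u, v} \<in> E \<longrightarrow> c u \<noteq> c v) :: rat)"
    using fin by (simp add: Int_def)
  also have "\<dots> = (\<Sum>c\<in>V \<rightarrow>\<^sub>E {..<q}. \<Sum>\<pi>\<in>?P.
      if \<forall>B\<in>\<pi>. monochromatic c B then \<Prod>B\<in>\<pi>. conn_sum E B else 0)"
  proof (rule sum.cong[OF refl])
    fix c :: "'a \<Rightarrow> nat"
    have "(\<Prod>B\<in>\<pi>. if monochromatic c B then conn_sum E B else 0)
      = (if \<forall>B\<in>\<pi>. monochromatic c B then \<Prod>B\<in>\<pi>. conn_sum E B else 0)" if "\<pi> \<in> ?P" for \<pi>
      using finite_elements[OF V, of \<pi>] that by (auto intro!: prod_zero prod.cong)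
    then have "part_sum (\<lambda>B. if monochromatic c B then conn_sum E B else 0) V = (\<Sum>\<pi>\<in>?P.
        if \<forall>B\<in>\<pi>. monochromatic c B then \<Prod>B\<in>\<pi>. conn_sum E B else 0)"
      unfolding part_sum_def by (rule sum.cong[OF refl])
    moreover have "part_sum (\<lambda>B. if monochromatic c B then conn_sum E B else 0) V
        = of_bool (\<forall>u\<in>V. \<forall>v\<in>V. {u, v} \<in> E \<longrightarrow> c u \<noteq> c v)"
      using V card2 by (rule part_sum_monochromatic)
    ultimately show "of_bool (\<forall>u\<in>V. \<forall>v\<in>V. {u, v} \<in> E \<longrightarrow> c u \<noteq> c v) = (\<Sum>\<pi>\<in>?P.
      if \<forall>B\<in>\<pi>. monochromatic c B then \<Prod>B\<in>\<pi>. conn_sum E B else 0)"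
      by (rule trans[OF sym, rotated])
  qed
  also have "\<dots> = (\<Sum>\<pi>\<in>?P. \<Sum>c\<in>V \<rightarrow>\<^sub>E {..<q}.
      if \<forall>B\<in>\<pi>. monochromatic c B then \<Prod>B\<in>\<pi>. conn_sum E B else 0)"
    by (rule sum.swap)
  also have "\<dots> = (\<Sum>\<pi>\<in>?P. (\<Prod>B\<in>\<pi>. conn_sum E B) * of_nat q ^ card \<pi>)"
  proof (rule sum.cong[OF refl], clarify)
    fix \<pi> assume \<pi>: "partition_on V \<pi>"
    have "(\<Sum>c\<in>V \<rightarrow>\<^sub>E {..<q}. if \<forall>B\<in>\<pi>. monochromatic c B then \<Prod>B\<in>\<pi>. conn_sum E B else 0)
      = (\<Sum>c | c \<in> V \<rightarrow>\<^sub>E {..<q} \<and> (\<forall>B\<in>\<pi>. monochromatic c B). \<Prod>B\<in>\<pi>. conn_sum E B)"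
      using fin by (rule sum.inter_filter[symmetric])
    also have "\<dots> = (\<Prod>B\<in>\<pi>. conn_sum E B) * of_nat q ^ card \<pi>"
      using card_monochromatic_blocks[OF V \<pi>, of q] by (simp add: mult.commute)
    finally show "(\<Sum>c\<in>V \<rightarrow>\<^sub>E {..<q}. if \<forall>B\<in>\<pi>. monochromatic c B then \<Prod>B\<in>\<pi>. conn_sum E B else 0)
      = (\<Prod>B\<in>\<pi>. conn_sum E B) * of_nat q ^ card \<pi>" .
  qed
  finally show ?thesis .
qed


section \<open>The chromatic polynomial as a sum over the bond lattice\<close>

text \<open>Signed sums must count each edge once, whereas \<open>parcs\<close> contains both
  orientations.\<close>

definition edge_sets :: "'a pair_pre_digraph \<Rightarrow> 'a set set" where
  "edge_sets G = {{u, v} | u v. (u, v) \<in> parcs G}"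

context pair_graph
begin

lemma edge_sets_iff: "{u, v} \<in> edge_sets G \<longleftrightarrow> (u, v) \<in> parcs G"
  unfolding edge_sets_def using arcs_symmetric by (auto simp: doubleton_eq_iff)

lemma card_edge_sets: "e \<in> edge_sets G \<Longrightarrow> card e = 2"
  unfolding edge_sets_def using no_loops' by (auto simp: card_2_iff) blast

text \<open>Walks cannot leave a side of an uncrossed cut; conversely, the set reachable from
  \<open>u\<close> within \<open>S\<close> has no edge leaving it and is therefore all of
  \<open>S\<close>. As the arcs are symmetric, the symmetric closure inside \<open>connected\<close>
  changes nothing.\<close>

lemma connected_subset_iff: "connected_subset G S \<longleftrightarrow> S \<subseteq> pverts G \<and> spans (edge_sets G) S"
proof -
  have "connected (with_proj G \<restriction> S) \<longleftrightarrow> spans (edge_sets G) S" if S: "S \<subseteq> pverts G"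
  proof -
    let ?R = "{(u, v) \<in> parcs G. u \<in> S \<and> v \<in> S}"
    have ends: "arcs_ends (with_proj G \<restriction> S) = ?R"
      by (auto simp: arcs_ends_conv)
    have sym: "symcl ?R = ?R" using arcs_symmetric by (auto simp: symcl_def)
    have conn: "connected (with_proj G \<restriction> S) \<longleftrightarrow>
        S \<noteq> {} \<and> (\<forall>u\<in>S. \<forall>v\<in>S. (u, v) \<in> rtrancl_on S ?R)"
      by (simp only: connected_conv ends sym) simp
    show ?thesis
    proof
      assume "connected (with_proj G \<restriction> S)"
      then have ne: "S \<noteq> {}" and reach: "\<And>u v. u \<in> S \<Longrightarrow> v \<in> S \<Longrightarrow> (u, v) \<in> rtrancl_on S ?R"
        unfolding conn by auto
      show "spans (edge_sets G) S"
        unfolding spans_def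
      proof (intro conjI allI impI)
        fix X assume X: "X \<subseteq> S" "X \<noteq> {}" "X \<noteq> S"
        then obtain x y where xy: "x \<in> X" "y \<in> S" "y \<notin> X" by auto
        have "z \<in> X" if "(x, z) \<in> rtrancl_on S ?R" "\<not> (\<exists>x\<in>X. \<exists>y\<in>S - X. {x, y} \<in> edge_sets G)" for z
          using that(1)
        proof (induction rule: rtrancl_on_induct)
          case (step y z)
          then show ?case using that(2) by (auto simp: edge_sets_iff)
        qed (use xy in auto)
        then show "\<exists>x\<in>X. \<exists>y\<in>S - X. {x, y} \<in> edge_sets G"
          using reach[of x y] xy X by blast
      qed (fact ne)
    next
      assume sp: "spans (edge_sets G) S"
      have "(u, v) \<in> rtrancl_on S ?R" if u: "u \<in> S" and v: "v \<in> S" for u v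
      proof (rule ccontr)
        assume nr: "(u, v) \<notin> rtrancl_on S ?R"
        let ?X = "{x \<in> S. (u, x) \<in> rtrancl_on S ?R}"
        have "?X \<subseteq> S" "?X \<noteq> {}" "?X \<noteq> S" using u v nr by auto
        from spans_cut[OF sp this] obtain x y
          where xy: "x \<in> ?X" "y \<in> S" "y \<notin> ?X" "{x, y} \<in> edge_sets G" .
        have "(u, x) \<in> rtrancl_on S ?R" "(x, y) \<in> ?R" using xy by (simp_all add: edge_sets_iff)
        from rtrancl_on_into_rtrancl_on[OF this xy(2)] show False using xy(2,3) by simp
      qed
      moreover have "S \<noteq> {}" using sp by (auto simp: spans_def)
      ultimately show "connected (with_proj G \<restriction> S)" unfolding conn by blast
    qed
  qed
  then show ?thesis by (auto simp: connected_subset_def)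
qed

section \<open>Counting edges through arcs\<close>

lemma edges_within_eq: "edges_within G S = card (inner_edges (edge_sets G) S)"
  unfolding edges_within_def inner_edges_def edge_sets_def
  by (rule arg_cong[where f = card]) auto

text \<open>Forgetting the orientation is two-to-one, since without loops the two arcs of an edge
  are distinct.\<close>

lemma card_arcs_within:
  "card {(u, v) \<in> parcs G. u \<in> S \<and> v \<in> S} = 2 * edges_within G S"
proof -
  let ?A = "{(u, v) \<in> parcs G. u \<in> S \<and> v \<in> S}"
  let ?E = "inner_edges (edge_sets G) S"
  let ?h = "\<lambda>(u, v). {u, v}"
  have finA: "finite ?A" by (rule finite_subset[OF _ pair_finite_arcs]) auto
  have E: "?E = ?h ` ?A" by (auto simp: inner_edges_def edge_sets_def)
  have "card ?A = (\<Sum>e\<in>?E. card {p \<in> ?A. ?h p = e})"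
    using sum.group[OF finA _ , of ?E ?h "\<lambda>_. 1::nat"] finA unfolding E by simp
  also have "\<dots> = (\<Sum>e\<in>?E. 2)"
  proof (rule sum.cong[OF refl])
    fix e assume "e \<in> ?E"
    then obtain u v where e: "e = {u, v}" "(u, v) \<in> parcs G" "u \<in> S" "v \<in> S" unfolding E by auto
    then have "{p \<in> ?A. ?h p = e} = {(u, v), (v, u)}"
      using arcs_symmetric by (auto simp: doubleton_eq_iff)
    moreover have "u \<noteq> v" using e no_loops' by blast
    ultimately show "card {p \<in> ?A. ?h p = e} = 2" by simp
  qed
  finally show ?thesis by (simp add: edges_within_eq)
qed

text \<open>Disjointness leaves only one orientation of each edge leading from \<open>S\<close> to
  \<open>T\<close>.\<close>

lemma edges_between_eq:
  assumes "S \<inter> T = {}"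
  shows "edges_between G S T = card {(u, v) \<in> parcs G. u \<in> S \<and> v \<in> T}"
proof -
  let ?A = "{(u, v) \<in> parcs G. u \<in> S \<and> v \<in> T}"
  have "inj_on (\<lambda>(u, v). {u, v}) ?A"
    using assms by (auto simp: inj_on_def doubleton_eq_iff)
  then have "card ((\<lambda>(u, v). {u, v}) ` ?A) = card ?A" by (rule card_image)
  moreover have "(\<lambda>(u, v). {u, v}) ` ?A = {{u, v} | u v. (u, v) \<in> parcs G \<and> u \<in> S \<and> v \<in> T}"
    by auto
  ultimately show ?thesis by (simp add: edges_between_def)
qed

text \<open>Sum \<open>conn_sum_edge\<close> over all arcs inside \<open>S\<close>; each edge is counted in both orientations.\<close>
lemma edges_within_conn_sum:
  assumes S: "S \<subseteq> pverts G"
  shows "2 * of_nat (edges_within G S) * conn_sum (edge_sets G) S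
    = - (\<Sum>X | X \<subseteq> S. of_nat (edges_between G X (S - X))
        * (conn_sum (edge_sets G) X * conn_sum (edge_sets G) (S - X)))"
proof -
  let ?a = "conn_sum (edge_sets G)"
  let ?A = "{(u, v) \<in> parcs G. u \<in> S \<and> v \<in> S}"
  let ?P = "\<lambda>p X. fst p \<in> X \<and> snd p \<notin> X"
  have finS: "finite S" using S pair_finite_verts finite_subset by blast
  have finA: "finite ?A" by (rule finite_subset[OF _ pair_finite_arcs]) auto
  have "2 * of_nat (edges_within G S) * ?a S = (\<Sum>p\<in>?A. ?a S)"
    using card_arcs_within[of S] by simp
  also have "\<dots> = (\<Sum>p\<in>?A. - (\<Sum>X | X \<in> Pow S \<and> ?P p X. ?a X * ?a (S - X)))"
  proof (rule sum.cong[OF refl], clarify)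
    fix u v assume uv: "(u, v) \<in> parcs G" "u \<in> S" "v \<in> S"
    then have "?a S = - (\<Sum>X | X \<subseteq> S \<and> u \<in> X \<and> v \<notin> X. ?a X * ?a (S - X))"
      by (intro conn_sum_edge[OF finS card_edge_sets]) (auto simp: edge_sets_iff)
    then show "?a S = - (\<Sum>X | X \<in> Pow S \<and> ?P (u, v) X. ?a X * ?a (S - X))" by simp
  qed
  \<comment> \<open>After the exchange, a fixed \<open>X\<close> collects exactly the arcs that
    leave it within \<open>S\<close>, the number of which is
    \<open>edges_between G X (S - X)\<close>.\<close>
  also have "\<dots> = - (\<Sum>X\<in>Pow S. \<Sum>p | p \<in> ?A \<and> ?P p X. ?a X * ?a (S - X))"
    unfolding sum_negf using finA finS by (subst sum.swap_restrict) auto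
  also have "\<dots> = - (\<Sum>X\<in>Pow S. of_nat (edges_between G X (S - X)) * (?a X * ?a (S - X)))"
  proof (intro arg_cong[where f = uminus] sum.cong[OF refl])
    fix X assume "X \<in> Pow S"
    then have "{p. p \<in> ?A \<and> ?P p X} = {(u, v) \<in> parcs G. u \<in> X \<and> v \<in> S - X}" by auto
    then show "(\<Sum>p | p \<in> ?A \<and> ?P p X. ?a X * ?a (S - X))
        = of_nat (edges_between G X (S - X)) * (?a X * ?a (S - X))"
      by (simp add: edges_between_eq)
  qed
  finally show ?thesis by (simp add: Pow_def)
qed

text \<open>This keeps the denominator of the edge weight nonzero: the cut around a single vertex
  must be crossed.\<close>

lemma edges_within_pos:
  assumes "connected_subset G S" "card S > 1"
  shows "edges_within G S > 0"
proof -
  have sp: "spans (edge_sets G) S" and S: "S \<subseteq> pverts G" using assms by (auto simp: connected_subset_iff)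
  have finS: "finite S" using S pair_finite_verts finite_subset by blast
  obtain z where z: "z \<in> S" using assms(2) by fastforce
  have "{z} \<subseteq> S" "{z} \<noteq> {}" "{z} \<noteq> S" using z assms(2) by auto
  from spans_cut[OF sp this] obtain x y where "x \<in> {z}" "y \<in> S" "{x, y} \<in> edge_sets G" .
  with z have "x \<in> S" "y \<in> S" "{x, y} \<in> edge_sets G" by auto
  then have "{x, y} \<in> inner_edges (edge_sets G) S" by (auto simp: inner_edges_def)
  moreover have "finite (inner_edges (edge_sets G) S)"
    by (rule finite_subset[of _ "Pow S"]) (use finS in \<open>auto simp: inner_edges_def\<close>)
  ultimately show ?thesis unfolding edges_within_eq by (auto simp: card_gt_0_iff)
qed

lemma finite_bond_lattice: "finite (bond_lattice G)"
  by (rule finite_subset[OF _ finitely_many_partition_on[OF pair_finite_verts]])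
    (auto simp: bond_lattice_def)

text \<open>The values at natural numbers come from \<open>card_colorings_part_sum\<close>, where
  partitions outside the lattice contribute zero; these values determine the polynomial.\<close>

lemma chromatic_polynomial_bond_lattice:
  "chromatic_polynomial G
    = (\<Sum>\<pi>\<in>bond_lattice G. monom (\<Prod>B\<in>\<pi>. conn_sum (edge_sets G) B) (card \<pi>))"
proof -
  let ?f = "\<Sum>\<pi>\<in>bond_lattice G. monom (\<Prod>B\<in>\<pi>. conn_sum (edge_sets G) B) (card \<pi>)"
  have "poly ?f (of_nat q) = of_nat (card (proper_colorings G q))" for q
  proof -
    have *: "proper_colorings G q
      = {c \<in> pverts G \<rightarrow>\<^sub>E {..<q}. \<forall>u\<in>pverts G. \<forall>v\<in>pverts G. {u, v} \<in> edge_sets G \<longrightarrow> c u \<noteq> c v}"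
      unfolding proper_colorings_def edge_sets_iff using in_arcsD1 in_arcsD2 by blast
    have "of_nat (card (proper_colorings G q)) =
      (\<Sum>\<pi> | partition_on (pverts G) \<pi>. (\<Prod>B\<in>\<pi>. conn_sum (edge_sets G) B) * of_nat q ^ card \<pi>)"
      unfolding * using pair_finite_verts card_edge_sets by (rule card_colorings_part_sum)
    also have "\<dots> = (\<Sum>\<pi>\<in>bond_lattice G. (\<Prod>B\<in>\<pi>. conn_sum (edge_sets G) B) * of_nat q ^ card \<pi>)"
    proof (rule sum.mono_neutral_right)
      show "\<forall>\<pi>\<in>{\<pi>. partition_on (pverts G) \<pi>} - bond_lattice G.
          (\<Prod>B\<in>\<pi>. conn_sum (edge_sets G) B) * of_nat q ^ card \<pi> = 0"
      proof
        fix \<pi> assume "\<pi> \<in> {\<pi>. partition_on (pverts G) \<pi>} - bond_lattice G"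
        then have \<pi>: "partition_on (pverts G) \<pi>" "\<pi> \<notin> bond_lattice G" by auto
        then obtain B where B: "B \<in> \<pi>" "\<not> connected_subset G B"
          unfolding bond_lattice_def by blast
        moreover have "B \<subseteq> pverts G" using B partition_onD1[OF \<pi>(1)] by auto
        ultimately have "conn_sum (edge_sets G) B = 0"
          by (simp add: connected_subset_iff conn_sum_eq_0)
        then have "(\<Prod>B\<in>\<pi>. conn_sum (edge_sets G) B) = 0"
          using B(1) finite_elements[OF pair_finite_verts \<pi>(1)] by (intro prod_zero) auto
        then show "(\<Prod>B\<in>\<pi>. conn_sum (edge_sets G) B) * of_nat q ^ card \<pi> = 0" by simp
      qed
    qed (use finitely_many_partition_on[OF pair_finite_verts] in \<open>auto simp: bond_lattice_def\<close>)
    finally show ?thesis by (simp add: poly_sum poly_monom)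
  qed
  then have "is_chromatic_polynomial G ?f" unfolding is_chromatic_polynomial_def by simp
  then show ?thesis
    unfolding chromatic_polynomial_def
    using chromatic_polynomial_ex1[OF pair_graph_axioms] by (intro the1_equality)
qed

end


section \<open>Covers in the bond lattice\<close>

text \<open>Sending a block of \<open>P\<close> to the block of \<open>Q\<close> around it is onto.
  If it were injective, every block of \<open>Q\<close> would consist of a single block of
  \<open>P\<close>, forcing equality. The number of blocks thus serves as a rank.\<close>

lemma refines_card_less:
  assumes V: "finite V" and ref: "refines V P Q" and ne: "P \<noteq> Q"
  shows "card Q < card P"
proof -
  have P: "partition_on V P" and Q: "partition_on V Q" using ref by (auto simp: refines_def)
  have finP: "finite P" using finite_elements[OF V P] .
  have "\<forall>X\<in>P. \<exists>Y. Y \<in> Q \<and> X \<subseteq> Y" using ref by (auto simp: refines_def)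
  then obtain f where f: "\<And>X. X \<in> P \<Longrightarrow> f X \<in> Q \<and> X \<subseteq> f X"
    using bchoice[of P "\<lambda>X Y. Y \<in> Q \<and> X \<subseteq> Y"] by blast
  have f_eq: "f X = Y" if "X \<in> P" "Y \<in> Q" "X \<subseteq> Y" for X Y
  proof (rule ccontr)
    assume "f X \<noteq> Y"
    then have "f X \<inter> Y = {}" using f[OF that(1)] that(2) partition_onD2[OF Q] by (auto simp: disjoint_def)
    then have "X = {}" using f[OF that(1)] that(3) by blast
    then show False using that(1) partition_onD3[OF P] by simp
  qed
  have below: "Y = \<Union>{X \<in> P. X \<subseteq> Y}" if "Y \<in> Q" for Y
    using refines_obtains_subset[OF ref that] by (rule partition_onD1)
  have img: "f ` P = Q"
  proof (intro equalityI subsetI)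
    fix Y assume Y: "Y \<in> Q"
    then have "Y \<noteq> {}" using partition_onD3[OF Q] by auto
    then obtain X where "X \<in> P" "X \<subseteq> Y" using below[OF Y] by blast
    then show "Y \<in> f ` P" using f_eq Y by blast
  qed (use f in auto)
  show ?thesis
  proof (rule ccontr)
    assume "\<not> card Q < card P"
    then have "card (f ` P) = card P" using card_image_le[OF finP, of f] img by simp
    then have inj: "inj_on f P" using finP by (intro eq_card_imp_inj_on)
    have "P \<subseteq> Q"
    proof
      fix X assume X: "X \<in> P"
      have "X' = X" if "X' \<in> P" "X' \<subseteq> f X" for X'
        using f_eq[OF that(1) _ that(2)] f[OF X] inj_onD[OF inj _ that(1) X] by blast
      then have "{X' \<in> P. X' \<subseteq> f X} = {X}" using f[OF X] X by blast
      then have "f X = X" using below[of "f X"] f[OF X] by auto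
      then show "X \<in> Q" using f[OF X] by auto
    qed
    moreover have "finite Q" using img finP by auto
    moreover have "card P = card Q" using \<open>card (f ` P) = card P\<close> img by simp
    ultimately show False using ne card_subset_eq by blast
  qed
qed

lemma partition_on_split_block:
  assumes \<pi>: "partition_on V \<pi>" and S: "S \<in> \<pi>" "X \<subseteq> S" "X \<noteq> {}" "X \<noteq> S"
  shows "partition_on V (insert X (insert (S - X) (\<pi> - {S})))"
    and "X \<notin> insert (S - X) (\<pi> - {S})" "S - X \<notin> \<pi> - {S}"
    and "S \<notin> insert X (insert (S - X) (\<pi> - {S}))"
    and "finite \<pi> \<Longrightarrow> card (insert X (insert (S - X) (\<pi> - {S}))) = card \<pi> + 1"
proof -
  have dj: "S \<inter> T = {}" if "T \<in> \<pi> - {S}" for T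
    using that \<pi> S(1) by (auto simp: partition_on_def disjoint_def)
  have ne: "{} \<notin> \<pi>" using \<pi> by (simp add: partition_on_def)
  have sub: "T \<notin> \<pi> - {S}" if "T \<subseteq> S" "T \<noteq> {}" for T using dj[of T] that by auto
  show 1: "S - X \<notin> \<pi> - {S}" using sub[of "S - X"] S by auto
  show 2: "X \<notin> insert (S - X) (\<pi> - {S})" using sub[of X] S by auto
  show "S \<notin> insert X (insert (S - X) (\<pi> - {S}))" using S by auto
  show "card (insert X (insert (S - X) (\<pi> - {S}))) = card \<pi> + 1" if fin: "finite \<pi>"
  proof -
    have "card (insert (S - X) (\<pi> - {S})) = Suc (card (\<pi> - {S}))"
      using 1 fin by (intro card_insert_disjoint) auto
    then show ?thesis
      using card_insert_disjoint[OF _ 2] fin card.remove[OF fin S(1)] by simp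
  qed
  have r: "partition_on (V - S) (\<pi> - {S})" by (rule partition_on_remove_block[OF \<pi> S(1)])
  have SV: "S \<subseteq> V" using S(1) partition_onD1[OF \<pi>] by auto
  have "V - X - (S - X) = V - S" using S(2) by auto
  then have "partition_on (V - X - (S - X)) (\<pi> - {S})" using r by (simp only:)
  from partition_on_insert_block(1)[OF this] have "partition_on (V - X) (insert (S - X) (\<pi> - {S}))"
    using S SV by auto
  from partition_on_insert_block(1)[OF this] show "partition_on V (insert X (insert (S - X) (\<pi> - {S})))"
    using S SV by auto
qed

lemma partition_on_merge_blocks:
  assumes \<pi>: "partition_on V \<pi>" and S: "S \<in> \<pi>" "T \<in> \<pi>" "S \<noteq> T"
  shows "partition_on V (insert (S \<union> T) (\<pi> - {S, T}))"
proof -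
  have "partition_on (V - S - T) (\<pi> - {S} - {T})"
    using partition_on_remove_block[OF partition_on_remove_block[OF \<pi> S(1)], of T] S by auto
  moreover have "V - S - T = V - (S \<union> T)" "\<pi> - {S} - {T} = \<pi> - {S, T}" by auto
  moreover have "S \<union> T \<subseteq> V" "S \<union> T \<noteq> {}"
    using S partition_onD1[OF \<pi>] partition_onD3[OF \<pi>] by auto
  ultimately show ?thesis using partition_on_insert_block(1) by metis
qed

context pair_graph
begin

section \<open>Covers as splittings of one block into two connected parts\<close>

lemma connected_subset_nonempty: "connected_subset G S \<Longrightarrow> S \<noteq> {}"
  by (simp add: connected_subset_iff spans_def)

text \<open>The split adds one block, while two strict refinements in succession would add at least
  two.\<close>

lemma bond_covers_split:
  assumes \<pi>: "\<pi> \<in> bond_lattice G" and S: "S \<in> \<pi>" "X \<subseteq> S"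
    and conn: "connected_subset G X" "connected_subset G (S - X)"
  shows "bond_covers G \<pi> (insert X (insert (S - X) (\<pi> - {S})))"
proof -
  let ?\<pi>' = "insert X (insert (S - X) (\<pi> - {S}))"
  have part: "partition_on (pverts G) \<pi>" using \<pi> by (simp add: bond_lattice_def)
  have X: "X \<noteq> {}" "X \<noteq> S" using conn connected_subset_nonempty by auto
  note split = partition_on_split_block[OF part S X]
  have fin: "finite \<pi>" using finite_elements[OF pair_finite_verts part] .
  have card: "card ?\<pi>' = card \<pi> + 1"
    using split(5)[OF fin] .
  have L: "?\<pi>' \<in> bond_lattice G"
    using split(1) \<pi> conn by (auto simp: bond_lattice_def)
  have less: "bond_less G ?\<pi>' \<pi>"
    using split(1,4) part S by (auto simp: bond_less_def refines_def)
  have "\<not> (bond_less G ?\<pi>' \<sigma> \<and> bond_less G \<sigma> \<pi>)" for \<sigma>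
    using refines_card_less[OF pair_finite_verts, of ?\<pi>' \<sigma>]
      refines_card_less[OF pair_finite_verts, of \<sigma> \<pi>] card
    unfolding bond_less_def by linarith
  then show ?thesis unfolding bond_covers_def using \<pi> L less by blast
qed

text \<open>Some block \<open>S\<close> of \<open>\<pi>\<close> is not a block of
  \<open>\<pi>'\<close>; being connected, it contains an edge between two blocks of
  \<open>\<pi>'\<close>. Merging these yields a lattice element strictly above \<open>\<pi>'\<close>
  that refines \<open>\<pi>\<close>, and the cover condition identifies it with
  \<open>\<pi>\<close>.\<close>

lemma bond_covers_obtains_split:
  assumes cov: "bond_covers G \<pi> \<pi>'"
  obtains S X where "S \<in> \<pi>" "X \<subseteq> S" "connected_subset G X" "connected_subset G (S - X)"
    "\<pi>' = insert X (insert (S - X) (\<pi> - {S}))"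
proof -
  have L: "\<pi> \<in> bond_lattice G" "\<pi>' \<in> bond_lattice G"
    and ref: "refines (pverts G) \<pi>' \<pi>" and ne: "\<pi>' \<noteq> \<pi>"
    and min: "\<And>\<sigma>. \<sigma> \<in> bond_lattice G \<Longrightarrow> bond_less G \<pi>' \<sigma> \<Longrightarrow> \<not> bond_less G \<sigma> \<pi>"
    using cov by (auto simp: bond_covers_def bond_less_def)
  have part: "partition_on (pverts G) \<pi>" "partition_on (pverts G) \<pi>'"
    using L by (auto simp: bond_lattice_def)
  have "\<not> \<pi> \<subseteq> \<pi>'"
  proof
    assume "\<pi> \<subseteq> \<pi>'"
    then have "refines (pverts G) \<pi> \<pi>'" using part by (auto simp: refines_def)
    then show False using refines_asym[OF ref] ne by simp
  qed
  then obtain S where S: "S \<in> \<pi>" "S \<notin> \<pi>'" by auto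
  have subpart: "partition_on S {p \<in> \<pi>'. p \<subseteq> S}"
    using refines_obtains_subset[OF ref S(1)] .
  have sp: "spans (edge_sets G) S" using L(1) S(1) by (auto simp: bond_lattice_def connected_subset_iff)
  then have "S \<noteq> {}" by (simp add: spans_def)
  then have "{p \<in> \<pi>'. p \<subseteq> S} \<noteq> {}" using subpart by (metis partition_on_empty partition_onD1 Union_empty)
  then obtain X where X: "X \<in> \<pi>'" "X \<subseteq> S" by auto
  have "X \<noteq> {}" "X \<noteq> S" using X S partition_onD3[OF part(2)] by auto
  from spans_cut[OF sp X(2) this] obtain x y
    where xy: "x \<in> X" "y \<in> S" "y \<notin> X" "{x, y} \<in> edge_sets G" .
  then obtain Y where Y: "Y \<in> \<pi>'" "Y \<subseteq> S" "y \<in> Y" using partition_onD1[OF subpart] by blast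
  have "X \<noteq> Y" using xy Y by auto
  let ?\<sigma> = "insert (X \<union> Y) (\<pi>' - {X, Y})"
  have part_\<sigma>: "partition_on (pverts G) ?\<sigma>"
    by (rule partition_on_merge_blocks[OF part(2) X(1) Y(1) \<open>X \<noteq> Y\<close>])
  have conn: "connected_subset G X" "connected_subset G Y" using L(2) X Y by (auto simp: bond_lattice_def)
  \<comment> \<open>Both edge sets are taken to be all of \<open>edge_sets G\<close>, so the joining
    edge is absorbed.\<close>
  then have "spans (insert {x, y} (edge_sets G \<union> edge_sets G)) (X \<union> Y)"
    using xy Y by (intro spans_join) (auto simp: connected_subset_iff)
  then have "connected_subset G (X \<union> Y)"
    using conn xy(4) by (simp add: connected_subset_iff insert_absorb)
  then have L_\<sigma>: "?\<sigma> \<in> bond_lattice G" using part_\<sigma> L(2) by (auto simp: bond_lattice_def)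
  have "X \<inter> Y = {}" using X Y \<open>X \<noteq> Y\<close> partition_onD2[OF part(2)] by (auto simp: disjoint_def)
  have "X \<union> Y \<notin> \<pi>'"
  proof
    assume "X \<union> Y \<in> \<pi>'"
    moreover have "X \<union> Y \<noteq> X" "(X \<union> Y) \<inter> X \<noteq> {}" using Y(3) xy(1,3) by auto
    ultimately show False using disjointD[OF partition_onD2[OF part(2)]] X(1) by blast
  qed
  then have "?\<sigma> \<noteq> \<pi>'" by blast
  then have "bond_less G \<pi>' ?\<sigma>" using part part_\<sigma> by (auto simp: bond_less_def refines_def)
  moreover have "refines (pverts G) ?\<sigma> \<pi>"
    using ref part_\<sigma> S(1) X(2) Y(2) by (auto simp: refines_def)
  ultimately have \<sigma>: "?\<sigma> = \<pi>" using min[OF L_\<sigma>] by (auto simp: bond_less_def)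
  moreover have "(X \<union> Y) \<inter> S \<noteq> {}" using X(2) xy(1) by auto
  ultimately have "X \<union> Y = S"
    using disjointD[OF partition_onD2[OF part(1)], of "X \<union> Y" S] S(1) by blast
  then have "S - X = Y" using \<open>X \<inter> Y = {}\<close> by auto
  moreover have "\<pi> - {S} = \<pi>' - {X, Y}"
    using \<sigma> \<open>X \<union> Y \<notin> \<pi>'\<close> \<open>X \<union> Y = S\<close> by auto
  ultimately show thesis
    using that[OF S(1) X(2)] conn X(1) Y(1) by (simp add: insert_absorb) blast
qed

text \<open>The lattice is graded by the number of blocks, so the length of a path to the bottom
  depends only on its start.\<close>

lemma bond_covers_card:
  assumes "bond_covers G \<pi> \<pi>'"
  shows "card \<pi>' = card \<pi> + 1"
proof -
  obtain S X where S: "S \<in> \<pi>" "X \<subseteq> S" "connected_subset G X" "connected_subset G (S - X)"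
    and \<pi>': "\<pi>' = insert X (insert (S - X) (\<pi> - {S}))"
    using bond_covers_obtains_split[OF assms] by blast
  have part: "partition_on (pverts G) \<pi>" using assms by (simp add: bond_covers_def bond_lattice_def)
  have "X \<noteq> {}" "X \<noteq> S" using S connected_subset_nonempty by auto
  note split = partition_on_split_block[OF part S(1,2) this]
  show ?thesis
    unfolding \<pi>' using split(5)[OF finite_elements[OF pair_finite_verts part]] .
qed

text \<open>The singletons refine every partition, so the bottom alone attains the maximal number of
  blocks.\<close>

lemma card_bond_lattice_le:
  assumes "\<pi> \<in> bond_lattice G"
  shows "card \<pi> \<le> card (pverts G)" and "\<pi> \<noteq> bond_bot G \<Longrightarrow> card \<pi> < card (pverts G)"
proof -
  have part: "partition_on (pverts G) \<pi>" using assms by (simp add: bond_lattice_def)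
  have bot: "refines (pverts G) (bond_bot G) \<pi>"
    using part partition_onD1[OF part] partition_on_singletons[of "pverts G"]
    by (auto simp: refines_def bond_bot_def)
  have card: "card (bond_bot G) = card (pverts G)"
    by (simp add: bond_bot_def card_image)
  show less: "card \<pi> < card (pverts G)" if "\<pi> \<noteq> bond_bot G"
    using refines_card_less[OF pair_finite_verts bot] that card by auto
  show "card \<pi> \<le> card (pverts G)" using less card by (cases "\<pi> = bond_bot G") auto
qed


section \<open>Weighted paths\<close>

text \<open>On the bond lattice this is the Moebius function from the bottom to
  \<open>\<pi>\<close>.\<close>

definition block_prod :: "'a set set \<Rightarrow> rat" where
  "block_prod \<pi> = (\<Prod>B\<in>\<pi>. conn_sum (edge_sets G) B)"

text \<open>Grouping by the block first lets the sum over covers be evaluated one block at a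
  time.\<close>

definition splittings :: "'a set set \<Rightarrow> ('a set \<times> 'a set) set" where
  "splittings \<pi> = (SIGMA S:\<pi>. {X. X \<subseteq> S \<and> connected_subset G X \<and> connected_subset G (S - X)})"

definition split_at :: "'a set set \<Rightarrow> 'a set \<times> 'a set \<Rightarrow> 'a set set" where
  "split_at \<pi> = (\<lambda>(S, X). insert X (insert (S - X) (\<pi> - {S})))"

text \<open>Each cover arises twice because a splitting is ordered: \<open>(S, X)\<close> and \<open>(S, S - X)\<close>.\<close>
lemma card_splittings_fibre:
  assumes cov: "bond_covers G \<pi> \<pi>'"
  shows "card {t \<in> splittings \<pi>. split_at \<pi> t = \<pi>'} = 2"
proof -
  have part: "partition_on (pverts G) \<pi>" using cov by (simp add: bond_covers_def bond_lattice_def)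
  obtain S X where S: "S \<in> \<pi>" "X \<subseteq> S" "connected_subset G X" "connected_subset G (S - X)"
    and \<pi>': "\<pi>' = insert X (insert (S - X) (\<pi> - {S}))"
    using bond_covers_obtains_split[OF cov] by blast
  have XX: "X \<noteq> {}" "X \<noteq> S" "S - X \<noteq> {}" "X \<noteq> S - X"
    using S(3,4) connected_subset_nonempty by auto
  have dd: "S - (S - X) = X" using S(2) by auto
  have S_notin: "S \<notin> \<pi>'" using partition_on_split_block(4)[OF part S(1,2) XX(1,2)] \<pi>' by simp
  have "{t \<in> splittings \<pi>. split_at \<pi> t = \<pi>'} = {(S, X), (S, S - X)}"
  proof (intro equalityI subsetI)
    fix t assume t: "t \<in> {t \<in> splittings \<pi>. split_at \<pi> t = \<pi>'}"
    obtain S' X' where p: "t = (S', X')" by (cases t)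
    have S': "S' \<in> \<pi>" "X' \<subseteq> S'" "connected_subset G X'" "connected_subset G (S' - X')"
      and eq: "insert X' (insert (S' - X') (\<pi> - {S'})) = \<pi>'"
      using t unfolding p splittings_def split_at_def by auto
    have "S = S'" using S(1) S_notin eq by blast
    have "X' \<in> \<pi>'" using eq by auto
    moreover have "X' \<notin> \<pi> - {S}"
    proof
      assume *: "X' \<in> \<pi> - {S}"
      then have "X' \<inter> S = {}" using S(1) partition_onD2[OF part] by (auto simp: disjoint_def)
      then show False using S'(2,3) \<open>S = S'\<close> connected_subset_nonempty by blast
    qed
    ultimately have "X' = X \<or> X' = S - X" using \<pi>' by blast
    then show "t \<in> {(S, X), (S, S - X)}" using p \<open>S = S'\<close> by auto
  next
    fix t assume "t \<in> {(S, X), (S, S - X)}"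
    then show "t \<in> {t \<in> splittings \<pi>. split_at \<pi> t = \<pi>'}"
      using S dd by (auto simp: splittings_def split_at_def \<pi>')
  qed
  then show ?thesis using XX(4) by simp
qed

lemma block_prod_split_at:
  assumes \<pi>: "\<pi> \<in> bond_lattice G" and t: "(S, X) \<in> splittings \<pi>"
  shows "block_prod (split_at \<pi> (S, X)) = conn_sum (edge_sets G) X * conn_sum (edge_sets G) (S - X)
      * block_prod (\<pi> - {S})"
    and "edge_weight G \<pi> (split_at \<pi> (S, X)) = 1 / of_nat (num_nonsingletons \<pi>)
      * (of_nat (edges_between G X (S - X)) / of_nat (edges_within G S))"
proof -
  have part: "partition_on (pverts G) \<pi>" using \<pi> by (simp add: bond_lattice_def)
  have S: "S \<in> \<pi>" "X \<subseteq> S" "connected_subset G X" "connected_subset G (S - X)"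
    using t by (auto simp: splittings_def)
  have XX: "X \<noteq> {}" "X \<noteq> S" using S(3,4) connected_subset_nonempty by auto
  note spl = partition_on_split_block[OF part S(1,2) XX]
  have fin: "finite (\<pi> - {S})" using finite_elements[OF pair_finite_verts part] by simp
  show "block_prod (split_at \<pi> (S, X)) = conn_sum (edge_sets G) X * conn_sum (edge_sets G) (S - X)
      * block_prod (\<pi> - {S})"
    using spl(2,3) fin by (simp add: block_prod_def split_at_def mult.assoc)
  have "X \<notin> \<pi> - {S}" "X \<noteq> S - X" using spl(2) by auto
  then have "\<pi> - {S} = insert X (insert (S - X) (\<pi> - {S})) - {X, S - X}"
    using spl(3) by blast
  then show "edge_weight G \<pi> (split_at \<pi> (S, X)) = 1 / of_nat (num_nonsingletons \<pi>)
      * (of_nat (edges_between G X (S - X)) / of_nat (edges_within G S))"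
    unfolding split_at_def prod.case
    using S \<open>X \<noteq> S - X\<close> by (intro edge_weight_eq[OF pair_graph_axioms part spl(1)]) auto
qed

text \<open>This makes the division by the number of non-singleton blocks legitimate: if all blocks
  had size one, there would be as many blocks as vertices, which only the bottom attains.\<close>

lemma num_nonsingletons_pos:
  assumes \<pi>: "\<pi> \<in> bond_lattice G" and ne: "\<pi> \<noteq> bond_bot G"
  shows "num_nonsingletons \<pi> > 0"
proof (rule ccontr)
  have part: "partition_on (pverts G) \<pi>" using \<pi> by (simp add: bond_lattice_def)
  have fin: "finite \<pi>" using finite_elements[OF pair_finite_verts part] .
  assume "\<not> num_nonsingletons \<pi> > 0"
  then have small: "{S \<in> \<pi>. card S > 1} = {}" using fin by (auto simp: num_nonsingletons_def)
  have "card S = 1" if "S \<in> \<pi>" for S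
  proof -
    have "finite S" "S \<noteq> {}"
      using that partition_onD1[OF part] partition_onD3[OF part] pair_finite_verts
      by (auto intro: finite_subset)
    then have "card S > 0" by (simp add: card_gt_0_iff)
    then show ?thesis using small that by fastforce
  qed
  then have "(\<Sum>S\<in>\<pi>. card S) = card \<pi>" by simp
  then have "card (pverts G) = card \<pi>"
    using product_partition[OF part] partition_onD1[OF part] partition_onD2[OF part] pair_finite_verts
    by (metis Union_upper finite_subset)
  then show False using card_bond_lattice_le(2)[OF \<pi> ne] by simp
qed

text \<open>By \<open>edges_within_conn_sum\<close>, the covers splitting a given non-singleton
  block contribute \<open>- 1 / d\<close> times \<open>block_prod \<pi>\<close>, whichever block it
  is, and there are \<open>d\<close> such blocks. Ordered splittings double both sides.\<close>

lemma block_prod_covers: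
  assumes \<pi>: "\<pi> \<in> bond_lattice G" and ne: "\<pi> \<noteq> bond_bot G"
  shows "block_prod \<pi> = - (\<Sum>\<pi>' | bond_covers G \<pi> \<pi>'. edge_weight G \<pi> \<pi>' * block_prod \<pi>')"
proof -
  let ?a = "conn_sum (edge_sets G)"
  let ?g = "\<lambda>\<pi>'. edge_weight G \<pi> \<pi>' * block_prod \<pi>'"
  let ?C = "{\<pi>'. bond_covers G \<pi> \<pi>'}"
  let ?X = "\<lambda>S. {X. X \<subseteq> S \<and> connected_subset G X \<and> connected_subset G (S - X)}"
  define d where "d = (of_nat (num_nonsingletons \<pi>) :: rat)"
  have d: "d \<noteq> 0" using num_nonsingletons_pos[OF \<pi> ne] by (simp add: d_def)
  have part: "partition_on (pverts G) \<pi>" using \<pi> by (simp add: bond_lattice_def)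
  have fin: "finite \<pi>" using finite_elements[OF pair_finite_verts part] .
  have block: "S \<subseteq> pverts G" "finite S" "connected_subset G S" if "S \<in> \<pi>" for S
    using that \<pi> partition_onD1[OF part] pair_finite_verts finite_subset[of S "pverts G"]
    by (auto simp: bond_lattice_def)
  have finT: "finite (splittings \<pi>)"
    unfolding splittings_def using fin block(2) by (intro finite_SigmaI) auto
  have finC: "finite ?C"
    by (rule finite_subset[OF _ finite_bond_lattice]) (auto simp: bond_covers_def)
  have block_sum: "(\<Sum>X\<in>?X S. ?g (split_at \<pi> (S, X))) = (if card S > 1 then - 2 / d * block_prod \<pi> else 0)"
    if S: "S \<in> \<pi>" for S
  proof (cases "card S > 1")
    case True
    let ?r = "block_prod (\<pi> - {S}) / (d * of_nat (edges_within G S))"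
    have e: "of_nat (edges_within G S) \<noteq> (0::rat)" using edges_within_pos[OF block(3)[OF S] True] by simp
    have "(\<Sum>X\<in>?X S. ?g (split_at \<pi> (S, X)))
      = (\<Sum>X\<in>?X S. ?r * (of_nat (edges_between G X (S - X)) * (?a X * ?a (S - X))))"
    proof (rule sum.cong[OF refl])
      fix X assume "X \<in> ?X S"
      then have "(S, X) \<in> splittings \<pi>" using S by (simp add: splittings_def)
      from block_prod_split_at[OF \<pi> this]
      show "?g (split_at \<pi> (S, X)) = ?r * (of_nat (edges_between G X (S - X)) * (?a X * ?a (S - X)))"
        by (simp add: d_def)
    qed
    \<comment> \<open>The added subsets have an empty or disconnected part, whose
      \<open>conn_sum\<close> is zero.\<close>
    also have "\<dots> = (\<Sum>X | X \<subseteq> S. ?r * (of_nat (edges_between G X (S - X)) * (?a X * ?a (S - X))))"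
    proof (rule sum.mono_neutral_left)
      show "\<forall>X\<in>{X. X \<subseteq> S} - ?X S. ?r * (of_nat (edges_between G X (S - X)) * (?a X * ?a (S - X))) = 0"
      proof
        fix X assume X: "X \<in> {X. X \<subseteq> S} - ?X S"
        then have "\<not> spans (edge_sets G) X \<or> \<not> spans (edge_sets G) (S - X)"
          using block(1)[OF S] by (auto simp: connected_subset_iff)
        then have "?a X * ?a (S - X) = 0" using conn_sum_eq_0 by auto
        then show "?r * (of_nat (edges_between G X (S - X)) * (?a X * ?a (S - X))) = 0" by simp
      qed
    qed (use block(2)[OF S] in auto)
    also have "\<dots> = ?r * (- (2 * of_nat (edges_within G S) * ?a S))"
      unfolding edges_within_conn_sum[OF block(1)[OF S]] by (simp add: sum_distrib_left)
    also have "\<dots> = - 2 / d * (?a S * block_prod (\<pi> - {S}))" using d e by (simp add: field_simps)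
    also have "?a S * block_prod (\<pi> - {S}) = block_prod \<pi>"
      unfolding block_prod_def using prod.remove[OF fin S, of ?a] by simp
    finally show ?thesis using True by simp
  next
    case False
    have "?X S = {}"
    proof (rule ccontr)
      assume "?X S \<noteq> {}"
      then obtain X where X: "X \<subseteq> S" "connected_subset G X" "connected_subset G (S - X)" by auto
      obtain x y where "x \<in> X" "y \<in> S - X"
        using connected_subset_nonempty[OF X(2)] connected_subset_nonempty[OF X(3)] by auto
      then have xy: "x \<in> S" "y \<in> S" "x \<noteq> y" using X(1) by auto
      then have "card {x, y} \<le> card S" using block(2)[OF S] by (intro card_mono) auto
      then show False using False xy by simp
    qed
    then show ?thesis using False by (simp only: sum.empty if_False)
  qed
  have "2 * (\<Sum>\<pi>'\<in>?C. ?g \<pi>') = (\<Sum>\<pi>'\<in>?C. \<Sum>t\<in>{t \<in> splittings \<pi>. split_at \<pi> t = \<pi>'}. ?g (split_at \<pi> t))"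
    unfolding sum_distrib_left
  proof (rule sum.cong[OF refl])
    fix \<pi>' assume "\<pi>' \<in> ?C"
    then have "card {t \<in> splittings \<pi>. split_at \<pi> t = \<pi>'} = 2" using card_splittings_fibre by simp
    moreover have "(\<Sum>t\<in>{t \<in> splittings \<pi>. split_at \<pi> t = \<pi>'}. ?g (split_at \<pi> t))
        = (\<Sum>t\<in>{t \<in> splittings \<pi>. split_at \<pi> t = \<pi>'}. ?g \<pi>')"
      by (rule sum.cong) auto
    ultimately show "2 * ?g \<pi>' = (\<Sum>t\<in>{t \<in> splittings \<pi>. split_at \<pi> t = \<pi>'}. ?g (split_at \<pi> t))"
      by simp
  qed
  also have "\<dots> = (\<Sum>t\<in>splittings \<pi>. ?g (split_at \<pi> t))"
  proof (rule sum.group[OF finT finC])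
    show "split_at \<pi> ` splittings \<pi> \<subseteq> ?C"
      using bond_covers_split[OF \<pi>] by (auto simp: splittings_def split_at_def)
  qed
  also have "\<dots> = (\<Sum>S\<in>\<pi>. \<Sum>X\<in>?X S. ?g (split_at \<pi> (S, X)))"
    unfolding splittings_def using fin block(2)
    by (subst sum.Sigma) (auto simp: split_def)
  also have "\<dots> = (\<Sum>S\<in>\<pi>. if card S > 1 then - 2 / d * block_prod \<pi> else 0)"
    using block_sum by (rule sum.cong[OF refl])
  also have "\<dots> = (\<Sum>S | S \<in> \<pi> \<and> card S > 1. - 2 / d * block_prod \<pi>)"
    using fin by (rule sum.inter_filter[symmetric])
  also have "\<dots> = d * (- 2 / d * block_prod \<pi>)"
    by (simp only: sum_constant d_def num_nonsingletons_def)
  also have "\<dots> = - 2 * block_prod \<pi>" using d by simp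
  finally show ?thesis by simp
qed

text \<open>\<open>vwalk\<close> excludes the empty list, so the path of length zero is a
  one-element list.\<close>

definition paths_from :: "'a set set \<Rightarrow> 'a set set vwalk set" where
  "paths_from \<pi> = {p. vwalk p (with_proj (bond_digraph G)) \<and> hd p = \<pi> \<and> last p = bond_bot G}"

section \<open>Recursion over the first arc of a path\<close>

lemma bond_digraph_simps:
  "pverts (bond_digraph G) = bond_lattice G"
  "(\<pi>, \<pi>') \<in> parcs (bond_digraph G) \<longleftrightarrow> bond_covers G \<pi> \<pi>'"
  by (simp_all add: bond_digraph_def)

lemma vwalk_Cons_iff:
  "vwalk (\<pi> # p) (with_proj (bond_digraph G)) \<longleftrightarrow> \<pi> \<in> bond_lattice G \<and>
    (p = [] \<or> bond_covers G \<pi> (hd p) \<and> vwalk p (with_proj (bond_digraph G)))"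
  by (cases p) (auto simp: vwalk_def bond_digraph_simps)

lemma paths_from_rec:
  assumes \<pi>: "\<pi> \<in> bond_lattice G"
  shows "paths_from \<pi> = (if \<pi> = bond_bot G then {[\<pi>]} else {})
    \<union> (\<Union>\<pi>'\<in>{\<pi>'. bond_covers G \<pi> \<pi>'}. (#) \<pi> ` paths_from \<pi>')"
proof (rule set_eqI)
  fix p
  show "p \<in> paths_from \<pi> \<longleftrightarrow> p \<in> (if \<pi> = bond_bot G then {[\<pi>]} else {})
    \<union> (\<Union>\<pi>'\<in>{\<pi>'. bond_covers G \<pi> \<pi>'}. (#) \<pi> ` paths_from \<pi>')"
  proof (cases p)
    case Nil
    then show ?thesis by (auto simp: paths_from_def vwalk_def)
  next
    case (Cons \<sigma> q)
    have "q \<noteq> []" if "vwalk q (with_proj (bond_digraph G))" using that by (auto simp: vwalk_def)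
    then show ?thesis using \<pi> unfolding Cons
      by (auto simp: paths_from_def vwalk_Cons_iff image_iff)
  qed
qed

text \<open>The induction runs towards the bottom, and \<open>block_prod_covers\<close> matches the
  removal of the first arc. Finiteness is carried along to split the sum by the first step, the
  length to fix the exponent later.\<close>

lemma paths_from_sum:
  assumes "\<pi> \<in> bond_lattice G"
  shows "finite (paths_from \<pi>) \<and>
    (\<forall>p\<in>paths_from \<pi>. vwalk_length p + card \<pi> = card (pverts G)) \<and>
    (\<Sum>p\<in>paths_from \<pi>. (-1) ^ vwalk_length p * path_weight G p) = block_prod \<pi>"
  using assms
proof (induction "card (pverts G) - card \<pi>" arbitrary: \<pi> rule: less_induct)
  case less
  let ?C = "{\<pi>'. bond_covers G \<pi> \<pi>'}"
  let ?f = "\<lambda>p. (-1) ^ vwalk_length p * path_weight G p"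
  have finC: "finite ?C"
    by (rule finite_subset[OF _ finite_bond_lattice]) (auto simp: bond_covers_def)
  have C: "\<pi>' \<in> bond_lattice G" "card \<pi>' = card \<pi> + 1" "card \<pi>' \<le> card (pverts G)"
    if "bond_covers G \<pi> \<pi>'" for \<pi>'
    using that card_bond_lattice_le(1) bond_covers_card by (auto simp: bond_covers_def)
  have IH: "finite (paths_from \<pi>')"
    "\<And>p. p \<in> paths_from \<pi>' \<Longrightarrow> vwalk_length p + card \<pi>' = card (pverts G)"
    "(\<Sum>p\<in>paths_from \<pi>'. ?f p) = block_prod \<pi>'" if "bond_covers G \<pi> \<pi>'" for \<pi>'
    using less.hyps[of \<pi>'] C[OF that] by simp_all
  show ?case
  proof (cases "\<pi> = bond_bot G")
    case True
    then have "card \<pi> = card (pverts G)" by (simp add: bond_bot_def card_image)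
    \<comment> \<open>An element covered by the bottom would have more blocks than there are
      vertices.\<close>
    then have "?C = {}" using C by fastforce
    then have "paths_from \<pi> = {[\<pi>]}" using paths_from_rec[OF less.prems] True by simp
    moreover have "block_prod \<pi> = 1"
      unfolding True block_prod_def bond_bot_def
      by (simp add: prod.reindex conn_sum_singleton[OF card_edge_sets])
    ultimately show ?thesis using \<open>card \<pi> = card (pverts G)\<close> by (simp add: path_weight_def)
  next
    case False
    have Q: "paths_from \<pi> = (\<Union>\<pi>'\<in>?C. (#) \<pi> ` paths_from \<pi>')"
      using paths_from_rec[OF less.prems] False by simp
    have cons: "p \<noteq> [] \<and> hd p = \<pi>'" if "p \<in> paths_from \<pi>'" for p \<pi>'
      using that by (auto simp: paths_from_def vwalk_def)
    \<comment> \<open>Nonemptiness of \<open>p\<close> matters: the empty and the one-element list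
      both have length zero.\<close>
    have len: "vwalk_length (\<pi> # p) = vwalk_length p + 1" if "p \<in> paths_from \<pi>'" for p \<pi>'
      using cons[OF that] by (cases p) simp_all
    have "(\<Sum>p\<in>paths_from \<pi>. ?f p) = (\<Sum>\<pi>'\<in>?C. \<Sum>p\<in>(#) \<pi> ` paths_from \<pi>'. ?f p)"
      unfolding Q
    proof (rule sum.UNION_disjoint)
      have "paths_from \<sigma> \<inter> paths_from \<tau> = {}" if "\<sigma> \<noteq> \<tau>" for \<sigma> \<tau>
        using that by (auto simp: paths_from_def)
      then show "\<forall>\<sigma>\<in>?C. \<forall>\<tau>\<in>?C. \<sigma> \<noteq> \<tau> \<longrightarrow> (#) \<pi> ` paths_from \<sigma> \<inter> (#) \<pi> ` paths_from \<tau> = {}"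
        by (simp add: image_Int[OF inj_on_Cons1, symmetric])
    qed (use finC IH(1) in simp_all)
    also have "\<dots> = (\<Sum>\<pi>'\<in>?C. \<Sum>p\<in>paths_from \<pi>'. ?f (\<pi> # p))"
      by (simp add: sum.reindex)
    \<comment> \<open>The prepended arc contributes its weight and flips the sign.\<close>
    also have "\<dots> = (\<Sum>\<pi>'\<in>?C. \<Sum>p\<in>paths_from \<pi>'. - (edge_weight G \<pi> \<pi>' * ?f p))"
    proof (intro sum.cong[OF refl])
      fix \<pi>' p assume "p \<in> paths_from \<pi>'"
      note cons[OF this] len[OF this]
      then show "?f (\<pi> # p) = - (edge_weight G \<pi> \<pi>' * ?f p)"
        by (simp add: path_weight_def del: vwalk_length_simp)
    qed
    also have "\<dots> = - (\<Sum>\<pi>'\<in>?C. edge_weight G \<pi> \<pi>' * block_prod \<pi>')"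
      by (simp add: sum_negf sum_distrib_left[symmetric] IH(3) del: vwalk_length_simp)
    also have "\<dots> = block_prod \<pi>" using block_prod_covers[OF less.prems False] by simp
    finally have "(\<Sum>p\<in>paths_from \<pi>. ?f p) = block_prod \<pi>" .
    moreover have "vwalk_length p + card \<pi> = card (pverts G)" if p: "p \<in> paths_from \<pi>" for p
    proof -
      obtain \<pi>' q where q: "bond_covers G \<pi> \<pi>'" "q \<in> paths_from \<pi>'" "p = \<pi> # q" using p Q by auto
      show ?thesis using len[OF q(2)] IH(2)[OF q(1,2)] C(2)[OF q(1)] q(3)
        by (simp del: vwalk_length_simp)
    qed
    moreover have "finite (paths_from \<pi>)" unfolding Q using finC IH(1) by auto
    ultimately show ?thesis by blast
  qed
qed

text \<open>Grouped by starting partition, the paths from \<open>\<pi>\<close> add up to the term of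
  \<open>\<pi>\<close> in \<open>chromatic_polynomial_bond_lattice\<close>.\<close>

lemma chromatic_polynomial_paths:
  "chromatic_polynomial G =
    (\<Sum>p | vwalk p (with_proj (bond_digraph G)) \<and> last p = bond_bot G.
      monom ((-1) ^ vwalk_length p * path_weight G p) (card (pverts G) - vwalk_length p))"
proof -
  let ?f = "\<lambda>p. (-1) ^ vwalk_length p * path_weight G p"
  have U: "{p. vwalk p (with_proj (bond_digraph G)) \<and> last p = bond_bot G}
      = (\<Union>\<pi>\<in>bond_lattice G. paths_from \<pi>)"
    using hd_in_set by (fastforce simp: paths_from_def vwalk_def bond_digraph_simps)
  have "(\<Sum>p\<in>(\<Union>\<pi>\<in>bond_lattice G. paths_from \<pi>). monom (?f p) (card (pverts G) - vwalk_length p))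
    = (\<Sum>\<pi>\<in>bond_lattice G. \<Sum>p\<in>paths_from \<pi>. monom (?f p) (card (pverts G) - vwalk_length p))"
    using finite_bond_lattice paths_from_sum
    by (intro sum.UNION_disjoint) (auto simp: paths_from_def)
  also have "\<dots> = (\<Sum>\<pi>\<in>bond_lattice G. \<Sum>p\<in>paths_from \<pi>. monom (?f p) (card \<pi>))"
  proof (intro sum.cong[OF refl])
    fix \<pi> p assume "\<pi> \<in> bond_lattice G" "p \<in> paths_from \<pi>"
    \<comment> \<open>By this identity the subtraction on naturals is not truncated and yields
      \<open>card \<pi>\<close>.\<close>
    then have "vwalk_length p + card \<pi> = card (pverts G)" using paths_from_sum by blast
    then show "monom (?f p) (card (pverts G) - vwalk_length p) = monom (?f p) (card \<pi>)"
      by (metis add_diff_cancel_left')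
  qed
  also have "\<dots> = (\<Sum>\<pi>\<in>bond_lattice G. monom (block_prod \<pi>) (card \<pi>))"
  proof (rule sum.cong[OF refl])
    fix \<pi> assume "\<pi> \<in> bond_lattice G"
    then have "block_prod \<pi> = (\<Sum>p\<in>paths_from \<pi>. ?f p)" using paths_from_sum by simp
    then show "(\<Sum>p\<in>paths_from \<pi>. monom (?f p) (card \<pi>)) = monom (block_prod \<pi>) (card \<pi>)"
      by (auto intro!: poly_eqI simp: coeff_sum)
  qed
  finally show ?thesis
    unfolding U chromatic_polynomial_bond_lattice block_prod_def by simp
qed

end

theorem theorem1p6:
  fixes G :: "'a pair_pre_digraph" and l :: nat
  assumes "pair_graph G"
    and "card (pverts G) = l"
  shows "chromatic_polynomial G =
    (\<Sum>p | vwalk p (with_proj (bond_digraph G)) \<and> last p = bond_bot G.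
      monom ((-1) ^ vwalk_length p * path_weight G p) (l - vwalk_length p))"
  using pair_graph.chromatic_polynomial_paths[OF assms(1)] assms(2) by simp

end
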